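(* $$\mathbf{MGLB}=\bigcap_{n\ge1}\mathbf{MGLB}[n]\quad\text{and}\quad\mathbf{M}^+\mathbf{GrzB}=\bigcap_{n\ge1}\mathbf{M}^+\mathbf{GrzB}[n].$$
   Context: $\mathcal{L}_{\Diamond\exists}$ is the propositional language with two modalities $\Diamond,\exists$, with $\Box=\neg\Diamond\neg$ and $\forall=\neg\exists\neg$. $\mathbf{GL}=\mathbf{K}+\Box(\Box p\to p)\to\Box p$ and $\mathbf{Grz}=\mathbf{K}+\Box(\Box(p\to\Box p)\to p)\to p$ (in modality $\Diamond$), and $\mathbf{S5}$ is formulated in modality $\exists$. For a unimodal logic $\mathbf{L}$, the fusion $\mathbf{L}\otimes\mathbf{S5}$ is the least set of $\mathcal{L}_{\Diamond\exists}$-formulae containing the theorems of $\mathbf{L}$ and of $\mathbf{S5}$ and closed under Modus Ponens, Substitution, $\Box$-necessitation, and $\forall$-necessitation; "$+$" denotes the least extension containing the given formulae and closed under the same rules. Put $$\mathbf{MLB}=(\mathbf{L}\otimes\mathbf{S5})+(\exists\Diamond p\to\Diamond\exists p)+(\Diamond\exists p\to\exists\Diamond p)$$ (giving $\mathbf{MGLB}$ and $\mathbf{MGrzB}$), and $$\mathbf{M}^+\mathbf{GrzB}=\mathbf{MGrzB}+\Box\forall(\Box(\Box p\to\Box\forall p)\to\Box\forall p)\to\Box\forall p.$$ The finite depth formulae are $bd_1=\Diamond\Box p_1\to p_1$ and $bd_n=\Diamond(\Box p_n\wedge\neg bd_{n-1})\to p_n$ for $n\ge2$; for any logic $\mathbf{M}$,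 $\mathbf{M}[n]=\mathbf{M}+bd_n$. *)

theory Defs
  imports Main
begin

text \<open>
  Formulae with a diamond for every element of the type \<open>'m\<close>: \<open>unit fm\<close> is the unimodal
  language, and \<open>modality fm\<close> (below) is the language with the two modalities
  \<open>\<Diamond>\<close> and \<open>\<exists>\<close>.
\<close>

datatype 'm fm =
    Var nat
  | Falsum
  | Imp "'m fm" "'m fm" (infixr "\<^bold>\<longrightarrow>" 55)
  | Dia 'm "'m fm"

abbreviation Neg :: "'m fm \<Rightarrow> 'm fm" ("\<^bold>\<not> _" [70] 70)
  where "\<^bold>\<not> \<phi> \<equiv> \<phi> \<^bold>\<longrightarrow> Falsum"

abbreviation And :: "'m fm \<Rightarrow> 'm fm \<Rightarrow> 'm fm" (infixr "\<^bold>\<and>" 65)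
  where "\<phi> \<^bold>\<and> \<psi> \<equiv> \<^bold>\<not> (\<phi> \<^bold>\<longrightarrow> \<^bold>\<not> \<psi>)"

abbreviation Box :: "'m \<Rightarrow> 'm fm \<Rightarrow> 'm fm"
  where "Box m \<phi> \<equiv> \<^bold>\<not> (Dia m (\<^bold>\<not> \<phi>))"

abbreviation var_p ("\<^bold>p") where "\<^bold>p \<equiv> Var 0"
abbreviation var_q ("\<^bold>q") where "\<^bold>q \<equiv> Var 1"

primrec subst :: "(nat \<Rightarrow> 'm fm) \<Rightarrow> 'm fm \<Rightarrow> 'm fm" where
  "subst \<sigma> (Var i) = \<sigma> i"
| "subst \<sigma> Falsum = Falsum"
| "subst \<sigma> (\<phi> \<^bold>\<longrightarrow> \<psi>) = (subst \<sigma> \<phi> \<^bold>\<longrightarrow> subst \<sigma> \<psi>)"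
| "subst \<sigma> (Dia m \<phi>) = Dia m (subst \<sigma> \<phi>)"

text \<open>Propositional truth under an assignment that treats variables and
  formulae \<open>Dia m \<phi>\<close> as atoms.\<close>

primrec bool_eval :: "('m fm \<Rightarrow> bool) \<Rightarrow> 'm fm \<Rightarrow> bool" where
  "bool_eval v (Var i) = v (Var i)"
| "bool_eval v Falsum = False"
| "bool_eval v (\<phi> \<^bold>\<longrightarrow> \<psi>) = (bool_eval v \<phi> \<longrightarrow> bool_eval v \<psi>)"
| "bool_eval v (Dia m \<phi>) = v (Dia m \<phi>)"

definition tautologies :: "'m fm set" where
  "tautologies = {\<phi>. \<forall>v. bool_eval v \<phi>}"

inductive_set rule_closure :: "'m fm set \<Rightarrow> 'm fm set" for \<Gamma> :: "'m fm set" where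
  base: "\<phi> \<in> \<Gamma> \<Longrightarrow> \<phi> \<in> rule_closure \<Gamma>"
| modus_ponens: "(\<phi> \<^bold>\<longrightarrow> \<psi>) \<in> rule_closure \<Gamma> \<Longrightarrow> \<phi> \<in> rule_closure \<Gamma> \<Longrightarrow> \<psi> \<in> rule_closure \<Gamma>"
| substitution: "\<phi> \<in> rule_closure \<Gamma> \<Longrightarrow> subst \<sigma> \<phi> \<in> rule_closure \<Gamma>"
| necessitation: "\<phi> \<in> rule_closure \<Gamma> \<Longrightarrow> Box m \<phi> \<in> rule_closure \<Gamma>"

definition extend :: "'m fm set \<Rightarrow> 'm fm set \<Rightarrow> 'm fm set" (infixl "\<oplus>" 65) where
  "L \<oplus> \<Gamma> = rule_closure (L \<union> \<Gamma>)"


subsection \<open>Unimodal logics\<close>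

abbreviation udia :: "unit fm \<Rightarrow> unit fm" ("\<diamond> _" [70] 70) where "\<diamond> \<phi> \<equiv> Dia () \<phi>"
abbreviation ubox :: "unit fm \<Rightarrow> unit fm" ("\<box> _" [70] 70) where "\<box> \<phi> \<equiv> Box () \<phi>"

text \<open>
  As the diamond is primitive and \<open>\<box>\<close> stands for \<open>\<not>\<diamond>\<not>\<close>, the duality
  \<open>\<diamond>p \<leftrightarrow> \<not>\<box>\<not>p\<close> is not a tautology and does not follow from distribution and
  necessitation, so it is one of the axioms of K.
\<close>

definition K :: "unit fm set" where
  "K = rule_closure (tautologies \<union>
     {\<box> (\<^bold>p \<^bold>\<longrightarrow> \<^bold>q) \<^bold>\<longrightarrow> \<box> \<^bold>p \<^bold>\<longrightarrow> \<box> \<^bold>q,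
      \<diamond> \<^bold>p \<^bold>\<longrightarrow> \<^bold>\<not> \<box> \<^bold>\<not> \<^bold>p,
      \<^bold>\<not> \<box> \<^bold>\<not> \<^bold>p \<^bold>\<longrightarrow> \<diamond> \<^bold>p})"

definition GL :: "unit fm set" where
  "GL = K \<oplus> {\<box> (\<box> \<^bold>p \<^bold>\<longrightarrow> \<^bold>p) \<^bold>\<longrightarrow> \<box> \<^bold>p}"

definition Grz :: "unit fm set" where
  "Grz = K \<oplus> {\<box> (\<box> (\<^bold>p \<^bold>\<longrightarrow> \<box> \<^bold>p) \<^bold>\<longrightarrow> \<^bold>p) \<^bold>\<longrightarrow> \<^bold>p}"

definition S5 :: "unit fm set" where
  "S5 = K \<oplus> {\<^bold>p \<^bold>\<longrightarrow> \<diamond> \<^bold>p, \<diamond> \<diamond> \<^bold>p \<^bold>\<longrightarrow> \<diamond> \<^bold>p, \<^bold>p \<^bold>\<longrightarrow> \<box> \<diamond> \<^bold>p}"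


subsection \<open>Bimodal logics\<close>

datatype modality = Temp | Quant

abbreviation bdia :: "modality fm \<Rightarrow> modality fm" ("\<^bold>\<diamond> _" [70] 70) where "\<^bold>\<diamond> \<phi> \<equiv> Dia Temp \<phi>"
abbreviation bbox :: "modality fm \<Rightarrow> modality fm" ("\<^bold>\<box> _" [70] 70) where "\<^bold>\<box> \<phi> \<equiv> Box Temp \<phi>"
abbreviation bex :: "modality fm \<Rightarrow> modality fm" ("\<^bold>\<exists> _" [70] 70) where "\<^bold>\<exists> \<phi> \<equiv> Dia Quant \<phi>"
abbreviation ball :: "modality fm \<Rightarrow> modality fm" ("\<^bold>\<forall> _" [70] 70) where "\<^bold>\<forall> \<phi> \<equiv> Box Quant \<phi>"

text \<open>The unimodal logic \<open>L\<close> is read in the modality \<open>\<diamond>\<close>, and S5 in the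
  modality \<open>\<exists>\<close>.\<close>

definition fusion_S5 :: "unit fm set \<Rightarrow> modality fm set" where
  "fusion_S5 L = rule_closure (map_fm (\<lambda>_. Temp) ` L \<union> map_fm (\<lambda>_. Quant) ` S5)"

definition MB :: "unit fm set \<Rightarrow> modality fm set" where
  "MB L = fusion_S5 L \<oplus> {\<^bold>\<exists> \<^bold>\<diamond> \<^bold>p \<^bold>\<longrightarrow> \<^bold>\<diamond> \<^bold>\<exists> \<^bold>p} \<oplus> {\<^bold>\<diamond> \<^bold>\<exists> \<^bold>p \<^bold>\<longrightarrow> \<^bold>\<exists> \<^bold>\<diamond> \<^bold>p}"

definition MGLB :: "modality fm set" where
  "MGLB = MB GL"

definition MGrzB :: "modality fm set" where
  "MGrzB = MB Grz"

definition MplusGrzB :: "modality fm set" where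
  "MplusGrzB = MGrzB \<oplus>
     {\<^bold>\<box> \<^bold>\<forall> (\<^bold>\<box> (\<^bold>\<box> \<^bold>p \<^bold>\<longrightarrow> \<^bold>\<box> \<^bold>\<forall> \<^bold>p) \<^bold>\<longrightarrow> \<^bold>\<box> \<^bold>\<forall> \<^bold>p) \<^bold>\<longrightarrow> \<^bold>\<box> \<^bold>\<forall> \<^bold>p}"

text \<open>The value at \<open>0\<close> is a dummy: only \<open>bd n\<close> with \<open>n \<ge> 1\<close> is used.\<close>

fun bd :: "nat \<Rightarrow> modality fm" where
  "bd 0 = Falsum"
| "bd (Suc 0) = (\<^bold>\<diamond> \<^bold>\<box> (Var 1) \<^bold>\<longrightarrow> Var 1)"
| "bd (Suc (Suc n)) =
     (\<^bold>\<diamond> (\<^bold>\<box> (Var (Suc (Suc n))) \<^bold>\<and> \<^bold>\<not> (bd (Suc n))) \<^bold>\<longrightarrow> Var (Suc (Suc n)))"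

definition with_depth :: "modality fm set \<Rightarrow> nat \<Rightarrow> modality fm set" ("_\<lbrakk>_\<rbrakk>" [1000, 0] 1000) where
  "M\<lbrakk>n\<rbrakk> = M \<oplus> {bd n}"

end

theory Submission imports Defs begin

text \<open>
  A non-theorem \<open>\<phi>\<close> is refuted in the canonical model, where \<open>R\<close> (for \<open>\<diamond>\<close>) is transitive, \<open>E\<close>
  (for \<open>\<exists>\<close>) is an equivalence, and \<open>R\<close> and \<open>E\<close> commute. The type of a point is the set of
  subformulae of \<open>\<phi>\<close> true at it, and the cluster type is the set of types in its \<open>E\<close>-class; having a
  given cluster type is definable by a formula. Keep only the points maximal with respect to their
  cluster type (the GL or Grz axiom provides enough of them) and let \<open>y\<close> be a new successor of \<open>x\<close>
  if the cluster of \<open>y\<close> is above that of \<open>x\<close> and the types of \<open>x\<close> and \<open>y\<close> fit each other. As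
  relatedness is now a matter of clusters and types, \<open>\<phi>\<close> is still refuted and the relations still
  commute, while cluster types do not repeat along a strict chain. Hence the new frame has finite
  depth (its width may be infinite), and it validates the logic together with some \<open>bd n\<close>.
\<close>

subsection \<open>Kripke semantics\<close>

text \<open>The carrier \<open>W\<close> is explicit because the models live on proper subsets of a
  type: the maximal consistent sets among all sets of formulae, and later the points kept by
  thinning.\<close>

primrec sat :: "'w set \<Rightarrow> ('m \<Rightarrow> 'w \<Rightarrow> 'w \<Rightarrow> bool) \<Rightarrow> (nat \<Rightarrow> 'w \<Rightarrow> bool) \<Rightarrow> 'm fm \<Rightarrow> 'w \<Rightarrow> bool" where
  "sat W r V (Var i) w = V i w"
| "sat W r V Falsum w = False"
| "sat W r V (\<phi> \<^bold>\<longrightarrow> \<psi>) w = (sat W r V \<phi> w \<longrightarrow> sat W r V \<psi> w)"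
| "sat W r V (Dia m \<phi>) w = (\<exists>v\<in>W. r m w v \<and> sat W r V \<phi> v)"

lemma sat_Box: "sat W r V (Box m \<phi>) w \<longleftrightarrow> (\<forall>v\<in>W. r m w v \<longrightarrow> sat W r V \<phi> v)"
  by simp

lemma not_sat_ImpD: "\<not> sat W r V (\<phi> \<^bold>\<longrightarrow> \<psi>) w \<Longrightarrow> sat W r V \<phi> w \<and> \<not> sat W r V \<psi> w"
  by simp

lemma sat_ImpI: "(sat W r V \<phi> w \<Longrightarrow> sat W r V \<psi> w) \<Longrightarrow> sat W r V (\<phi> \<^bold>\<longrightarrow> \<psi>) w"
  by simp

lemma sat_ImpD: "sat W r V (\<phi> \<^bold>\<longrightarrow> \<psi>) w \<Longrightarrow> sat W r V \<phi> w \<Longrightarrow> sat W r V \<psi> w"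
  by simp

lemma sat_Imp_contra: "sat W r V (\<phi> \<^bold>\<longrightarrow> \<psi>) w \<Longrightarrow> \<not> sat W r V \<psi> w \<Longrightarrow> \<not> sat W r V \<phi> w"
  by simp

definition valid :: "'w set \<Rightarrow> ('m \<Rightarrow> 'w \<Rightarrow> 'w \<Rightarrow> bool) \<Rightarrow> 'm fm set" where
  "valid W r = {\<phi>. \<forall>V. \<forall>w\<in>W. sat W r V \<phi> w}"

lemma sat_subst: "sat W r V (subst \<sigma> \<phi>) w = sat W r (\<lambda>i. sat W r V (\<sigma> i)) \<phi> w"
  by (induction \<phi> arbitrary: w) auto

lemma sat_map_fm: "sat W r V (map_fm f \<phi>) w = sat W (\<lambda>m. r (f m)) V \<phi> w"
  by (induction \<phi> arbitrary: w) auto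

lemma bool_eval_sat: "bool_eval (\<lambda>\<phi>. sat W r V \<phi> w) \<phi> = sat W r V \<phi> w"
  by (induction \<phi>) auto

lemma tautologies_valid: "tautologies \<subseteq> valid W r"
  unfolding tautologies_def valid_def using bool_eval_sat by fastforce

lemma rule_closure_valid:
  assumes "\<Gamma> \<subseteq> valid W r"
  shows "rule_closure \<Gamma> \<subseteq> valid W r"
proof
  fix \<phi> assume "\<phi> \<in> rule_closure \<Gamma>"
  then show "\<phi> \<in> valid W r"
    by induction (use assms in \<open>auto simp: valid_def sat_subst\<close>)
qed

lemma extend_valid: "L \<subseteq> valid W r \<Longrightarrow> \<Gamma> \<subseteq> valid W r \<Longrightarrow> L \<oplus> \<Gamma> \<subseteq> valid W r"
  unfolding extend_def by (intro rule_closure_valid) auto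

lemma map_fm_valid: "L \<subseteq> valid W (\<lambda>m. r (f m)) \<Longrightarrow> map_fm f ` L \<subseteq> valid W r"
  by (auto simp: valid_def sat_map_fm)

lemma K_valid: "K \<subseteq> valid W r"
  unfolding K_def
  by (intro rule_closure_valid Un_least tautologies_valid) (auto simp: valid_def)

definition frel :: "('w \<Rightarrow> 'w \<Rightarrow> bool) \<Rightarrow> ('w \<Rightarrow> 'w \<Rightarrow> bool) \<Rightarrow> modality \<Rightarrow> 'w \<Rightarrow> 'w \<Rightarrow> bool" where
  "frel R E m = (case m of Temp \<Rightarrow> R | Quant \<Rightarrow> E)"

lemma frel_simps [simp]: "frel R E Temp = R" "frel R E Quant = E"
  by (auto simp: frel_def)

section \<open>Soundness on commuting frames of bounded rank\<close>

locale commuting_frame =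
  fixes W :: "'w set" and R E :: "'w \<Rightarrow> 'w \<Rightarrow> bool"
  assumes E_refl: "x \<in> W \<Longrightarrow> E x x"
    and E_sym: "x \<in> W \<Longrightarrow> y \<in> W \<Longrightarrow> E x y \<Longrightarrow> E y x"
    and E_trans: "x \<in> W \<Longrightarrow> y \<in> W \<Longrightarrow> z \<in> W \<Longrightarrow> E x y \<Longrightarrow> E y z \<Longrightarrow> E x z"
    and R_trans: "x \<in> W \<Longrightarrow> y \<in> W \<Longrightarrow> z \<in> W \<Longrightarrow> R x y \<Longrightarrow> R y z \<Longrightarrow> R x z"
    and ER_RE: "x \<in> W \<Longrightarrow> y \<in> W \<Longrightarrow> z \<in> W \<Longrightarrow> E x y \<Longrightarrow> R y z \<Longrightarrow> \<exists>u\<in>W. R x u \<and> E u z"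
    and RE_ER: "x \<in> W \<Longrightarrow> y \<in> W \<Longrightarrow> z \<in> W \<Longrightarrow> R x y \<Longrightarrow> E y z \<Longrightarrow> \<exists>u\<in>W. E x u \<and> R u z"
begin

lemma S5_valid: "S5 \<subseteq> valid W (\<lambda>_. E)"
  unfolding S5_def
proof (intro extend_valid K_valid)
  show "{\<^bold>p \<^bold>\<longrightarrow> \<diamond> \<^bold>p, \<diamond> \<diamond> \<^bold>p \<^bold>\<longrightarrow> \<diamond> \<^bold>p, \<^bold>p \<^bold>\<longrightarrow> \<box> \<diamond> \<^bold>p} \<subseteq> valid W (\<lambda>_. E)"
    by (simp add: valid_def) (meson E_refl E_sym E_trans)
qed

lemma MB_valid:
  assumes "L \<subseteq> valid W (\<lambda>_. R)"
  shows "MB L \<subseteq> valid W (frel R E)"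
proof -
  have "fusion_S5 L \<subseteq> valid W (frel R E)"
    unfolding fusion_S5_def
    by (intro rule_closure_valid Un_least map_fm_valid) (use assms S5_valid in auto)
  moreover have "{\<^bold>\<exists> \<^bold>\<diamond> \<^bold>p \<^bold>\<longrightarrow> \<^bold>\<diamond> \<^bold>\<exists> \<^bold>p} \<subseteq> valid W (frel R E)"
    using ER_RE by (simp add: valid_def) meson
  moreover have "{\<^bold>\<diamond> \<^bold>\<exists> \<^bold>p \<^bold>\<longrightarrow> \<^bold>\<exists> \<^bold>\<diamond> \<^bold>p} \<subseteq> valid W (frel R E)"
    using RE_ER by (simp add: valid_def) meson
  ultimately show ?thesis
    unfolding MB_def by (intro extend_valid)
qed

end

text \<open>Loops are exempt from the rank condition, so that irreflexive frames for GL and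
  reflexive frames for Grz are treated together.\<close>

locale ranked_frame = commuting_frame W R E for W :: "'w set" and R E +
  fixes rk :: "'w \<Rightarrow> nat"
  assumes rk_less: "x \<in> W \<Longrightarrow> y \<in> W \<Longrightarrow> R x y \<Longrightarrow> x \<noteq> y \<Longrightarrow> rk y < rk x"
begin

text \<open>A failure of \<open>bd n\<close> forces \<open>n\<close> strict \<open>R\<close>-steps.
  The point refutes the variable while its witness satisfies the box of it; a witness equal to the
  point would be a loop at which the variable both fails and holds. So \<open>rk_less\<close>
  applies at every level.\<close>

lemma not_bd_rank:
  "n \<ge> 1 \<Longrightarrow> x \<in> W \<Longrightarrow> \<not> sat W (frel R E) V (bd n) x \<Longrightarrow> rk x \<ge> n"
proof (induction n arbitrary: x rule: bd.induct)
  case 1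
  then show ?case by simp
next
  case 2
  then obtain y where "y \<in> W" "R x y" "\<not> V 1 x" "\<forall>z\<in>W. R y z \<longrightarrow> V 1 z"
    by auto
  then have "rk y < rk x" using rk_less[of x y] 2 by blast
  then show ?case by simp
next
  case (3 n)
  then obtain y where "y \<in> W" "R x y" "\<not> V (Suc (Suc n)) x"
    "\<forall>z\<in>W. R y z \<longrightarrow> V (Suc (Suc n)) z" "\<not> sat W (frel R E) V (bd (Suc n)) y"
    by auto
  then have "rk y < rk x" "rk y \<ge> Suc n" using rk_less[of x y] 3 by auto
  then show ?case by simp
qed

lemma with_depth_valid:
  assumes "M \<subseteq> valid W (frel R E)" "\<And>x. x \<in> W \<Longrightarrow> rk x < n" "n \<ge> 1"
  shows "M\<lbrakk>n\<rbrakk> \<subseteq> valid W (frel R E)"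
  unfolding with_depth_def
proof (rule extend_valid)
  show "{bd n} \<subseteq> valid W (frel R E)"
    using not_bd_rank assms(2,3) by (force simp: valid_def)
qed fact

lemma rank_maximal:
  assumes "x \<in> W" "P x"
  obtains y where "y \<in> W" "y = x \<or> R x y" "P y" "\<And>z. z \<in> W \<Longrightarrow> R y z \<Longrightarrow> z \<noteq> y \<Longrightarrow> \<not> P z"
proof -
  have "\<exists>y\<in>W. (y = x \<or> R x y) \<and> P y \<and> (\<forall>z\<in>W. R y z \<longrightarrow> z \<noteq> y \<longrightarrow> \<not> P z)"
    using assms
  proof (induction "rk x" arbitrary: x rule: less_induct)
    case less
    show ?case
    proof (cases "\<forall>z\<in>W. R x z \<longrightarrow> z \<noteq> x \<longrightarrow> \<not> P z")
      case False
      then obtain z where z: "z \<in> W" "R x z" "z \<noteq> x" "P z" by blast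
      then obtain y where "y \<in> W" "y = z \<or> R z y" "P y" "\<forall>u\<in>W. R y u \<longrightarrow> u \<noteq> y \<longrightarrow> \<not> P u"
        using less(1)[of z] rk_less[of x z] less(2) by blast
      then show ?thesis using z R_trans less(2) by blast
    qed (use less in auto)
  qed
  then show thesis using that by blast
qed

lemma GL_valid:
  assumes "\<And>x. x \<in> W \<Longrightarrow> \<not> R x x"
  shows "GL \<subseteq> valid W (\<lambda>_. R)"
proof -
  have "sat W (\<lambda>_. R) V (\<box> (\<box> \<^bold>p \<^bold>\<longrightarrow> \<^bold>p) \<^bold>\<longrightarrow> \<box> \<^bold>p) x" if x: "x \<in> W" for V x
  proof (rule ccontr)
    assume *: "\<not> ?thesis"
    then obtain y where y: "y \<in> W" "R x y" "\<not> V 0 y" by auto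
    then obtain z where z: "z \<in> W" "z = y \<or> R y z" "\<not> V 0 z"
      "\<And>u. u \<in> W \<Longrightarrow> R z u \<Longrightarrow> u \<noteq> z \<Longrightarrow> V 0 u"
      using rank_maximal[of y "\<lambda>x. \<not> V 0 x"] by metis
    have "R x z" using z(1,2) y(1,2) R_trans[of x y z] x by blast
    moreover have "\<forall>y\<in>W. R x y \<longrightarrow> (\<forall>u\<in>W. R y u \<longrightarrow> V 0 u) \<longrightarrow> V 0 y"
      using * by simp blast
    ultimately show False using z(1,3) z(4) assms by metis
  qed
  then show ?thesis
    unfolding GL_def by (intro extend_valid K_valid) (simp add: valid_def del: sat.simps)
qed

lemma Grz_valid:
  assumes "\<And>x. x \<in> W \<Longrightarrow> R x x"
  shows "Grz \<subseteq> valid W (\<lambda>_. R)"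
proof -
  have "sat W (\<lambda>_. R) V (\<box> (\<box> (\<^bold>p \<^bold>\<longrightarrow> \<box> \<^bold>p) \<^bold>\<longrightarrow> \<^bold>p) \<^bold>\<longrightarrow> \<^bold>p) x" if x: "x \<in> W" for V x
  proof (rule ccontr)
    assume *: "\<not> ?thesis"
    then have "\<not> V 0 x" by auto
    then obtain z where z: "z \<in> W" "z = x \<or> R x z" "\<not> V 0 z"
      "\<And>u. u \<in> W \<Longrightarrow> R z u \<Longrightarrow> u \<noteq> z \<Longrightarrow> V 0 u"
      using rank_maximal[of x "\<lambda>x. \<not> V 0 x"] x by metis
    have xz: "R x z" using z assms x by blast
    \<comment> \<open>At a last point \<open>z\<close> refuting \<open>p\<close>, \<open>p\<close>
      implies its own box at every successor \<open>u\<close>. The only danger is a return from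
      \<open>u\<close> to \<open>z\<close>: the rank forbids it for \<open>u\<close> distinct from
      \<open>z\<close>, and \<open>u = z\<close> contradicts \<open>V 0 u\<close>.\<close>
    have "V 0 v" if "u \<in> W" "R z u" "V 0 u" "v \<in> W" "R u v" for u v
    proof (cases "v = z")
      case True
      then have "u \<noteq> z \<Longrightarrow> False"
        using rk_less[of z u] rk_less[of u z] that z(1) by force
      then show ?thesis using that z by blast
    next
      case False
      then show ?thesis using z(1) z(4)[of v] that R_trans[of z u v] by blast
    qed
    moreover have "\<forall>y\<in>W. R x y \<longrightarrow> (\<forall>u\<in>W. R y u \<longrightarrow> V 0 u \<longrightarrow> (\<forall>v\<in>W. R u v \<longrightarrow> V 0 v)) \<longrightarrow> V 0 y"
      using * by simp blast
    ultimately have "V 0 z" using xz z(1) by blast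
    then show False using z by blast
  qed
  then show ?thesis
    unfolding Grz_def by (intro extend_valid K_valid) (simp add: valid_def del: sat.simps)
qed

text \<open>A refutation of the conclusion is moved to a last cluster containing a point
  \<open>w\<close> with \<open>p\<close> false. By reflexivity \<open>w\<close> refutes the box of
  "for all p", so the antecedent yields \<open>u\<close> above \<open>w\<close> with box
  \<open>p\<close> but with a bad cluster above it. Reflexivity excludes \<open>u = w\<close>, and
  the choice of the cluster excludes the rest.\<close>

lemma MplusGrzB_valid:
  assumes refl: "\<And>x. x \<in> W \<Longrightarrow> R x x"
    and clean: "\<And>x y. x \<in> W \<Longrightarrow> y \<in> W \<Longrightarrow> R x y \<Longrightarrow> E x y \<Longrightarrow> x = y"
  shows "MplusGrzB \<subseteq> valid W (frel R E)"
proof -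
  have "sat W (frel R E) V
     (\<^bold>\<box> \<^bold>\<forall> (\<^bold>\<box> (\<^bold>\<box> \<^bold>p \<^bold>\<longrightarrow> \<^bold>\<box> \<^bold>\<forall> \<^bold>p) \<^bold>\<longrightarrow> \<^bold>\<box> \<^bold>\<forall> \<^bold>p) \<^bold>\<longrightarrow> \<^bold>\<box> \<^bold>\<forall> \<^bold>p) x" if x: "x \<in> W" for V x
  proof (rule ccontr)
    assume *: "\<not> ?thesis"
    note imp = not_sat_ImpD[OF *]
    from conjunct2[OF imp] obtain y0 y1 where y: "y0 \<in> W" "R x y0" "y1 \<in> W" "E y0 y1" "\<not> V 0 y1"
      by (simp only: sat_Box frel_simps sat.simps(1)) blast
    from conjunct1[OF imp] have step: "sat W (frel R E) V (\<^bold>\<box> (\<^bold>\<box> \<^bold>p \<^bold>\<longrightarrow> \<^bold>\<box> \<^bold>\<forall> \<^bold>p) \<^bold>\<longrightarrow> \<^bold>\<box> \<^bold>\<forall> \<^bold>p) v"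
      if "z \<in> W" "R x z" "v \<in> W" "E z v" for z v
      using that by (simp only: sat_Box frel_simps)
    \<comment> \<open>An \<open>R\<close>-maximal point whose cluster refutes \<open>p\<close> also has an \<open>R\<close>-maximal cluster.\<close>
    define P where "P z \<longleftrightarrow> (\<exists>u\<in>W. E z u \<and> \<not> V 0 u)" for z
    have "P y0" using y P_def by blast
    obtain z where z: "z \<in> W" "z = y0 \<or> R y0 z" "P z"
      "\<And>u. u \<in> W \<Longrightarrow> R z u \<Longrightarrow> u \<noteq> z \<Longrightarrow> \<not> P u"
      using rank_maximal[of y0 P] y(1) \<open>P y0\<close> by blast
    have xz: "R x z" using z(1,2) y(1,2) x R_trans[of x y0 z] by blast
    obtain w where w: "w \<in> W" "E z w" "\<not> V 0 w" using z(3) P_def by blast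
    \<comment> \<open>A bad point \<open>b\<close> in the cluster of \<open>a\<close> pulls back
      along \<open>ER_RE\<close> to a point \<open>c\<close> above \<open>z\<close>, whence
      \<open>c = z\<close> by maximality. Then \<open>a\<close> lies in the cluster of
      \<open>w\<close>, so \<open>clean\<close> gives \<open>a = w\<close>, and the rank forbids the
      cycle through \<open>u\<close>.\<close>
    have above: "V 0 b" if ua: "u \<in> W" "R w u" "u \<noteq> w" "a \<in> W" "R u a" "b \<in> W" "E a b" for u a b
    proof (rule ccontr)
      assume b: "\<not> V 0 b"
      have wa: "R w a" using that R_trans[of w u a] w by blast
      then obtain c where c: "c \<in> W" "R z c" "E c a"
        using ER_RE[of z w a] z(1) w ua wa by blast
      then have Pc: "P c" unfolding P_def using b that E_trans[of c a b] by blast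
      then have "c = z" using z(4) c by blast
      then have "E w a" using c w z(1) that E_trans[of w z a] E_sym[of z w] by blast
      then have "w = a" using clean wa w that by blast
      then show False using rk_less[of w u] rk_less[of u a] that w by auto
    qed
    have "\<exists>u\<in>W. R w u \<and> (\<forall>v\<in>W. R u v \<longrightarrow> V 0 v) \<and> \<not> (\<forall>a\<in>W. R u a \<longrightarrow> (\<forall>b\<in>W. E a b \<longrightarrow> V 0 b))"
    proof -
      have "\<exists>a\<in>W. R w a \<and> (\<exists>b\<in>W. E a b \<and> \<not> V 0 b)"
        using w(1,3) refl[of w] E_refl[of w] by blast
      then show ?thesis using step[OF z(1) xz w(1,2)] by simp
    qed
    then obtain u a b where "u \<in> W" "R w u" "\<forall>v\<in>W. R u v \<longrightarrow> V 0 v" "a \<in> W" "R u a" "b \<in> W" "E a b" "\<not> V 0 b"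
      by meson
    then show False using above[of u a b] refl[of w] w by (cases "u = w") auto
  qed
  then show ?thesis
    unfolding MplusGrzB_def MGrzB_def
    by (intro extend_valid MB_valid Grz_valid refl) (simp_all add: valid_def del: sat.simps)
qed

end

subsection \<open>The canonical model\<close>

text \<open>Closure under substitution lets each axiom be given as a single formula in variables.
  The first three form a Hilbert basis of propositional logic; both dualities appear because
  \<open>Dia\<close> is primitive.\<close>

locale normal_logic =
  fixes L :: "'m fm set"
  assumes closed: "rule_closure L \<subseteq> L"
    and ax_const: "(Var 0 \<^bold>\<longrightarrow> Var 1 \<^bold>\<longrightarrow> Var 0) \<in> L"
    and ax_distr: "((Var 0 \<^bold>\<longrightarrow> Var 1 \<^bold>\<longrightarrow> Var 2) \<^bold>\<longrightarrow> (Var 0 \<^bold>\<longrightarrow> Var 1) \<^bold>\<longrightarrow> Var 0 \<^bold>\<longrightarrow> Var 2) \<in> L"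
    and ax_neg_neg: "(\<^bold>\<not> \<^bold>\<not> Var 0 \<^bold>\<longrightarrow> Var 0) \<in> L"
    and ax_normal: "(Box m (Var 0 \<^bold>\<longrightarrow> Var 1) \<^bold>\<longrightarrow> Box m (Var 0) \<^bold>\<longrightarrow> Box m (Var 1)) \<in> L"
    and ax_dual1: "(Dia m (Var 0) \<^bold>\<longrightarrow> \<^bold>\<not> Box m (\<^bold>\<not> Var 0)) \<in> L"
    and ax_dual2: "(\<^bold>\<not> Box m (\<^bold>\<not> Var 0) \<^bold>\<longrightarrow> Dia m (Var 0)) \<in> L"
begin

lemma inst: "\<phi> \<in> L \<Longrightarrow> subst \<sigma> \<phi> \<in> L"
  using closed rule_closure.substitution[OF rule_closure.base, of \<phi> L \<sigma>] by blast

lemma mp: "(\<phi> \<^bold>\<longrightarrow> \<psi>) \<in> L \<Longrightarrow> \<phi> \<in> L \<Longrightarrow> \<psi> \<in> L"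
  using closed rule_closure.modus_ponens[OF rule_closure.base rule_closure.base, of \<phi> \<psi> L] by blast

lemma nec: "\<phi> \<in> L \<Longrightarrow> Box m \<phi> \<in> L"
  using closed rule_closure.necessitation[OF rule_closure.base, of \<phi> L m] by blast

lemma const: "(a \<^bold>\<longrightarrow> b \<^bold>\<longrightarrow> a) \<in> L"
  using inst[OF ax_const, of "\<lambda>i. if i = 0 then a else b"] by simp

lemma distr: "((a \<^bold>\<longrightarrow> b \<^bold>\<longrightarrow> c) \<^bold>\<longrightarrow> (a \<^bold>\<longrightarrow> b) \<^bold>\<longrightarrow> a \<^bold>\<longrightarrow> c) \<in> L"
  using inst[OF ax_distr, of "\<lambda>i. if i = 0 then a else if i = 1 then b else c"] by simp

lemma neg_neg: "(\<^bold>\<not> \<^bold>\<not> a \<^bold>\<longrightarrow> a) \<in> L"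
  using inst[OF ax_neg_neg, of "\<lambda>_. a"] by simp

lemma normal: "(Box m (a \<^bold>\<longrightarrow> b) \<^bold>\<longrightarrow> Box m a \<^bold>\<longrightarrow> Box m b) \<in> L"
  using inst[OF ax_normal, of "\<lambda>i. if i = 0 then a else b"] by simp

lemma dual1: "(Dia m a \<^bold>\<longrightarrow> \<^bold>\<not> Box m (\<^bold>\<not> a)) \<in> L"
  using inst[OF ax_dual1, of "\<lambda>_. a"] by simp

lemma dual2: "(\<^bold>\<not> Box m (\<^bold>\<not> a) \<^bold>\<longrightarrow> Dia m a) \<in> L"
  using inst[OF ax_dual2, of "\<lambda>_. a"] by simp

lemma refl_imp: "(a \<^bold>\<longrightarrow> a) \<in> L"
  using mp[OF mp[OF distr const] const] .

text \<open>Only Modus Ponens is demanded, as these are theories of facts true at a point, where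
  necessitation and substitution would be unsound.\<close>

definition deductive :: "'m fm set \<Rightarrow> bool" where
  "deductive T \<longleftrightarrow> L \<subseteq> T \<and> (\<forall>a b. (a \<^bold>\<longrightarrow> b) \<in> T \<longrightarrow> a \<in> T \<longrightarrow> b \<in> T)"

lemma deductiveD: "deductive T \<Longrightarrow> (a \<^bold>\<longrightarrow> b) \<in> T \<Longrightarrow> a \<in> T \<Longrightarrow> b \<in> T"
  unfolding deductive_def by blast

lemma deductive_L: "deductive T \<Longrightarrow> a \<in> L \<Longrightarrow> a \<in> T"
  unfolding deductive_def by blast

lemma L_deductive: "deductive L"
  unfolding deductive_def using mp by blast

lemma deductive_const: "deductive T \<Longrightarrow> b \<in> T \<Longrightarrow> (a \<^bold>\<longrightarrow> b) \<in> T"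
  using deductiveD[of T b "a \<^bold>\<longrightarrow> b"] deductive_L[OF _ const] by blast

text \<open>The deduction theorem in semantic dress: the set is the theory generated by
  \<open>T\<close> and \<open>a\<close>, and its closure under Modus Ponens is exactly
  \<open>distr\<close>.\<close>

lemma deductive_Imp: "deductive T \<Longrightarrow> deductive {b. (a \<^bold>\<longrightarrow> b) \<in> T}"
  unfolding deductive_def[of "{b. (a \<^bold>\<longrightarrow> b) \<in> T}"]
  using deductive_const[of T] deductive_L[of T] deductiveD[OF _ deductiveD[OF _ deductive_L[OF _ distr]]] by blast

lemma deductive_Falsum: "deductive T \<Longrightarrow> Falsum \<in> T \<Longrightarrow> a \<in> T"
  by (meson deductiveD deductive_L const neg_neg)

definition world :: "'m fm set \<Rightarrow> bool" where
  "world w \<longleftrightarrow> deductive w \<and> Falsum \<notin> w \<and> (\<forall>a. a \<in> w \<or> (\<^bold>\<not> a) \<in> w)"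

text \<open>Case distinction without disjunction: under the assumption that \<open>b\<close> fails,
  \<open>a\<close> is refuted, so the second hypothesis produces \<open>b\<close> after all.
  Assumptions are added by passing to the theories \<open>?N\<close> and \<open>?N2\<close>.\<close>

lemma deductive_cases:
  assumes T: "deductive T" and "(a \<^bold>\<longrightarrow> b) \<in> T" "(\<^bold>\<not> a \<^bold>\<longrightarrow> b) \<in> T"
  shows "b \<in> T"
proof -
  let ?N = "{c. (\<^bold>\<not> b \<^bold>\<longrightarrow> c) \<in> T}"
  let ?N2 = "{c. (a \<^bold>\<longrightarrow> c) \<in> ?N}"
  have N: "deductive ?N" by (rule deductive_Imp[OF T])
  have N2: "deductive ?N2" by (rule deductive_Imp[OF N])
  have nb: "(\<^bold>\<not> b) \<in> ?N" using refl_imp deductive_L[OF T] by simp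
  then have "(\<^bold>\<not> b) \<in> ?N2" using deductive_const[OF N] by simp
  moreover have "b \<in> ?N2" using deductive_const[OF T assms(2)] by simp
  ultimately have "Falsum \<in> ?N2" by (rule deductiveD[OF N2])
  then have "(\<^bold>\<not> a) \<in> ?N" by simp
  moreover have "(\<^bold>\<not> a \<^bold>\<longrightarrow> b) \<in> ?N" using deductive_const[OF T assms(3)] by simp
  ultimately have "b \<in> ?N" using deductiveD[OF N] by blast
  then have "Falsum \<in> ?N" by (rule deductiveD[OF N nb])
  then show ?thesis using deductiveD[OF T] deductive_L[OF T neg_neg] by blast
qed

text \<open>Maximality is taken among deductive sets omitting \<open>b\<close>, so no compactness argument is needed.\<close>

lemma Lindenbaum:
  assumes T: "deductive T" and "b \<notin> T"
  obtains w where "world w" "T \<subseteq> w" "b \<notin> w"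
proof -
  let ?A = "{S. deductive S \<and> T \<subseteq> S \<and> b \<notin> S}"
  have "\<exists>M\<in>?A. \<forall>X\<in>?A. M \<subseteq> X \<longrightarrow> X = M"
  proof (rule subset_Zorn_nonempty)
    show "?A \<noteq> {}" using assms by blast
    fix C assume C: "C \<noteq> {}" "subset.chain ?A C"
    have CA: "deductive X \<and> T \<subseteq> X \<and> b \<notin> X" if "X \<in> C" for X
      using C(2) that unfolding subset_chain_def by blast
    have tot: "X \<subseteq> Y \<or> Y \<subseteq> X" if "X \<in> C" "Y \<in> C" for X Y
      using C(2) that unfolding subset_chain_def by blast
    obtain X0 where X0: "X0 \<in> C" using C(1) by blast
    have "deductive (\<Union>C)"
      unfolding deductive_def
    proof (intro conjI allI impI)
      show "L \<subseteq> \<Union>C" using X0 CA[OF X0] unfolding deductive_def by blast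
      fix c d assume "(c \<^bold>\<longrightarrow> d) \<in> \<Union>C" "c \<in> \<Union>C"
      then obtain X Y where XY: "X \<in> C" "Y \<in> C" "(c \<^bold>\<longrightarrow> d) \<in> X" "c \<in> Y" by blast
      then obtain Z where "Z \<in> C" "(c \<^bold>\<longrightarrow> d) \<in> Z" "c \<in> Z" using tot[OF XY(1,2)] by blast
      then show "d \<in> \<Union>C" using CA[of Z] deductiveD[of Z c d] by blast
    qed
    then show "\<Union>C \<in> ?A" using X0 CA by blast
  qed
  then obtain M where "M \<in> ?A" and max: "\<forall>X\<in>?A. M \<subseteq> X \<longrightarrow> X = M" by (rule bexE)
  then have M: "deductive M" "T \<subseteq> M" "b \<notin> M" by simp_all
  \<comment> \<open>The theory generated by \<open>M\<close> and \<open>a\<close> properly extends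
    \<open>M\<close>, so by maximality it contains \<open>b\<close>. Hence if both \<open>a\<close>
    and its negation were missing from \<open>M\<close>, \<open>deductive_cases\<close> would put
    \<open>b\<close> into \<open>M\<close>.\<close>
  have imp: "(a \<^bold>\<longrightarrow> b) \<in> M" if a: "a \<notin> M" for a
  proof (rule ccontr)
    assume "(a \<^bold>\<longrightarrow> b) \<notin> M"
    moreover have sub: "M \<subseteq> {c. (a \<^bold>\<longrightarrow> c) \<in> M}" using deductive_const[OF M(1)] by blast
    ultimately have "{c. (a \<^bold>\<longrightarrow> c) \<in> M} \<in> ?A"
      using deductive_Imp[OF M(1)] M(2) by simp
    then have "{c. (a \<^bold>\<longrightarrow> c) \<in> M} = M" using max sub by simp
    then show False using a deductive_L[OF M(1) refl_imp, of a] by blast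
  qed
  have "world M"
    unfolding world_def using M(1,3) deductive_Falsum[OF M(1)] deductive_cases[OF M(1) imp imp] by blast
  then show thesis using that M by blast
qed

lemma world_deductive: "world w \<Longrightarrow> deductive w"
  unfolding world_def by blast

lemma world_Falsum: "world w \<Longrightarrow> Falsum \<notin> w"
  unfolding world_def by blast

lemma world_Imp: "world w \<Longrightarrow> (a \<^bold>\<longrightarrow> b) \<in> w \<longleftrightarrow> (a \<in> w \<longrightarrow> b \<in> w)"
  using deductiveD[of w a b] deductive_const[of w b a] deductive_Falsum[OF deductive_Imp, of w a b]
  unfolding world_def by blast

lemma world_L: "world w \<Longrightarrow> a \<in> L \<Longrightarrow> a \<in> w"
  using world_deductive deductive_L by blast

lemma L_worlds: "(\<And>w. world w \<Longrightarrow> a \<in> w) \<Longrightarrow> a \<in> L"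
  using Lindenbaum[OF L_deductive] by metis

definition acc :: "'m \<Rightarrow> 'm fm set \<Rightarrow> 'm fm set \<Rightarrow> bool" where
  "acc m x y \<longleftrightarrow> (\<forall>a\<in>y. Dia m a \<in> x)"

lemma deductive_Box:
  assumes "deductive x" shows "deductive {a. Box m a \<in> x}"
  unfolding deductive_def[of "{a. Box m a \<in> x}"]
  using deductive_L[OF assms nec] deductiveD[OF assms deductiveD[OF assms deductive_L[OF assms normal]]] by blast

lemma Dia_Box_Neg: "world w \<Longrightarrow> Dia m a \<in> w \<longleftrightarrow> Box m (\<^bold>\<not> a) \<notin> w"
  using world_L[OF _ dual1, of w m a] world_L[OF _ dual2, of w m a] world_Imp[of w] world_Falsum[of w]
  by blast

lemma acc_Box:
  assumes x: "world x" and y: "world y"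
  shows "acc m x y \<longleftrightarrow> (\<forall>a. Box m a \<in> x \<longrightarrow> a \<in> y)"
proof
  assume "acc m x y"
  then show "\<forall>a. Box m a \<in> x \<longrightarrow> a \<in> y"
    unfolding acc_def using world_Imp[OF x] world_Imp[OF y] world_Falsum[OF x] by blast
next
  assume "\<forall>a. Box m a \<in> x \<longrightarrow> a \<in> y"
  then show "acc m x y"
    unfolding acc_def using Dia_Box_Neg[OF x] world_Imp[OF y] world_Falsum[OF y] by blast
qed

lemma world_Dia:
  assumes x: "world x"
  shows "Dia m a \<in> x \<longleftrightarrow> (\<exists>y. world y \<and> acc m x y \<and> a \<in> y)"
proof
  assume "Dia m a \<in> x"
  then have "(\<^bold>\<not> a) \<notin> {a. Box m a \<in> x}" using Dia_Box_Neg[OF x] by blast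
  then obtain y where y: "world y" "{a. Box m a \<in> x} \<subseteq> y" "(\<^bold>\<not> a) \<notin> y"
    using Lindenbaum[OF deductive_Box[OF world_deductive[OF x]]] by blast
  then show "\<exists>y. world y \<and> acc m x y \<and> a \<in> y"
    using acc_Box[OF x, of y m] world_Imp[of y] by blast
qed (auto simp: acc_def)

lemma Dia_mono: "(a \<^bold>\<longrightarrow> b) \<in> L \<Longrightarrow> (Dia m a \<^bold>\<longrightarrow> Dia m b) \<in> L"
  by (rule L_worlds) (meson world_Imp world_Dia world_L)

text \<open>The middle point is a world extending the theory generated by the box content of
  \<open>x\<close> and all \<open>Dia n a\<close> with \<open>a\<close> in \<open>z\<close>. If this
  theory were inconsistent, a single \<open>a\<close> would witness it, against
  \<open>dia\<close>.\<close>

lemma acc_comp: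
  assumes x: "world x" and z: "world z" and dia: "\<And>a. a \<in> z \<Longrightarrow> Dia m (Dia n a) \<in> x"
  obtains u where "world u" "acc m x u" "acc n u z"
proof -
  let ?B = "{c. Box m c \<in> x}"
  let ?T = "{c. \<exists>a\<in>z. (Dia n a \<^bold>\<longrightarrow> c) \<in> ?B}"
  have B: "deductive ?B" by (rule deductive_Box[OF world_deductive[OF x]])
  have top: "(Falsum \<^bold>\<longrightarrow> Falsum) \<in> z" using world_Imp[OF z] by simp
  have B_T: "c \<in> ?T" if "c \<in> ?B" for c using deductive_const[OF B that] top by blast
  have "deductive ?T"
    unfolding deductive_def
  proof (intro conjI allI impI subsetI)
    fix c assume "c \<in> L"
    then show "c \<in> ?T" using B_T deductive_L[OF B] by blast
  next
    fix c d assume "(c \<^bold>\<longrightarrow> d) \<in> ?T" "c \<in> ?T"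
    then obtain a b where ab: "a \<in> z" "b \<in> z"
      and cd: "(Dia n a \<^bold>\<longrightarrow> c \<^bold>\<longrightarrow> d) \<in> ?B" and c: "(Dia n b \<^bold>\<longrightarrow> c) \<in> ?B" by blast
    \<comment> \<open>One member of \<open>z\<close> must serve both derivations: the conjunction
      does, as \<open>Dia n\<close> is monotone and \<open>z\<close> is closed under
      conjunction.\<close>
    let ?N = "{c. (Dia n (a \<^bold>\<and> b) \<^bold>\<longrightarrow> c) \<in> ?B}"
    have N: "deductive ?N" by (rule deductive_Imp[OF B])
    have "(a \<^bold>\<and> b \<^bold>\<longrightarrow> a) \<in> L" "(a \<^bold>\<and> b \<^bold>\<longrightarrow> b) \<in> L"
      by (rule L_worlds; auto simp: world_Imp world_Falsum)+
    then have "Dia n a \<in> ?N" "Dia n b \<in> ?N"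
      using Dia_mono deductive_L[OF B] by blast+
    moreover have "(Dia n a \<^bold>\<longrightarrow> c \<^bold>\<longrightarrow> d) \<in> ?N" "(Dia n b \<^bold>\<longrightarrow> c) \<in> ?N"
      using deductive_const[OF B] cd c by blast+
    ultimately have "d \<in> ?N" using deductiveD[OF N] by blast
    moreover have "(a \<^bold>\<and> b) \<in> z" using ab world_Imp[OF z] world_Falsum[OF z] by simp
    ultimately show "d \<in> ?T" by blast
  qed
  moreover have "Falsum \<notin> ?T"
    using dia by (simp add: Dia_Box_Neg[OF x])
  ultimately obtain u where u: "world u" "?T \<subseteq> u" by (rule Lindenbaum)
  have "acc m x u" unfolding acc_Box[OF x u(1)] using B_T u(2) by blast
  moreover have "acc n u z"
    unfolding acc_def
  proof
    fix a assume "a \<in> z"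
    then have "Dia n a \<in> ?T" using deductive_L[OF B refl_imp] by blast
    then show "Dia n a \<in> u" using u(2) by blast
  qed
  ultimately show thesis using that u(1) by blast
qed

definition canonical_val :: "nat \<Rightarrow> 'm fm set \<Rightarrow> bool" where
  "canonical_val i w \<longleftrightarrow> Var i \<in> w"

lemma truth: "world w \<Longrightarrow> sat (Collect world) acc canonical_val \<phi> w \<longleftrightarrow> \<phi> \<in> w"
  by (induction \<phi> arbitrary: w) (auto simp: canonical_val_def world_Imp world_Falsum world_Dia)

lemma canonical_sound: "world w \<Longrightarrow> \<phi> \<in> L \<Longrightarrow> sat (Collect world) acc canonical_val \<phi> w"
  using truth world_L by blast

lemma canonical_complete: "\<phi> \<notin> L \<Longrightarrow> \<exists>w. world w \<and> \<not> sat (Collect world) acc canonical_val \<phi> w"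
  using truth L_worlds by blast

lemma acc_trans:
  assumes "\<And>a. (Dia m (Dia m a) \<^bold>\<longrightarrow> Dia m a) \<in> L" "world x" "acc m x y" "acc m y z"
  shows "acc m x z"
  using assms world_Imp[OF assms(2)] world_L[OF assms(2)] unfolding acc_def by blast

end

section \<open>Transitivity and reflexivity derived from the axioms of GL and Grz\<close>

text \<open>Suppose no successor of \<open>x\<close> satisfies \<open>a\<close>. At a successor, the
  box of \<open>?c\<close> gives the box of not \<open>a\<close>, hence \<open>?c\<close> itself.
  The Loeb axiom then gives the box of \<open>?c\<close> at \<open>x\<close>, so not
  \<open>a\<close> holds two steps away as well.\<close>

lemma dia_dia_GL:
  assumes "normal_logic L" and "\<And>a. (Box m (Box m a \<^bold>\<longrightarrow> a) \<^bold>\<longrightarrow> Box m a) \<in> L"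
  shows "(Dia m (Dia m a) \<^bold>\<longrightarrow> Dia m a) \<in> L"
proof -
  interpret normal_logic L by fact
  let ?sat = "sat (Collect world) acc canonical_val"
  show ?thesis
  proof (rule L_worlds)
    fix x assume x: "world x"
    show "(Dia m (Dia m a) \<^bold>\<longrightarrow> Dia m a) \<in> x"
    proof (rule ccontr)
      assume "\<not> ?thesis"
      then obtain y z where yz: "world y" "world z" "acc m x y" "acc m y z" "?sat a z"
        and no: "\<And>y. world y \<Longrightarrow> acc m x y \<Longrightarrow> \<not> ?sat a y"
        unfolding truth[OF x, symmetric] by auto
      let ?c = "\<^bold>\<not> a \<^bold>\<and> Box m (\<^bold>\<not> a)"
      have "?sat (Box m (Box m ?c \<^bold>\<longrightarrow> ?c)) x" using no by auto
      then have "?sat (Box m ?c) x"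
        by (rule sat_ImpD[OF canonical_sound[OF x assms(2)]])
      then show False using yz by auto
    qed
  qed
qed

text \<open>In the instance for not \<open>a\<close>, if no successor satisfies \<open>a\<close>
  then the outer box holds because its inner conclusion is true everywhere, so \<open>a\<close>
  fails at the point itself.\<close>

lemma dia_Grz:
  assumes "normal_logic L" and "\<And>a. (Box m (Box m (a \<^bold>\<longrightarrow> Box m a) \<^bold>\<longrightarrow> a) \<^bold>\<longrightarrow> a) \<in> L"
  shows "(a \<^bold>\<longrightarrow> Dia m a) \<in> L"
proof -
  interpret normal_logic L by fact
  let ?sat = "sat (Collect world) acc canonical_val"
  show ?thesis
  proof (rule L_worlds)
    fix x assume x: "world x"
    have "?sat (Box m (Box m (\<^bold>\<not> a \<^bold>\<longrightarrow> Box m (\<^bold>\<not> a)) \<^bold>\<longrightarrow> \<^bold>\<not> a) \<^bold>\<longrightarrow> \<^bold>\<not> a) x"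
      by (rule canonical_sound[OF x assms(2)])
    then have "?sat (a \<^bold>\<longrightarrow> Dia m a) x" by auto
    then show "(a \<^bold>\<longrightarrow> Dia m a) \<in> x" using truth[OF x] by blast
  qed
qed

text \<open>Grz is applied to \<open>?c\<close>, which adds to not \<open>a\<close> the very
  instance of transitivity in question. Once \<open>?c\<close> holds at \<open>x\<close>, a point
  where all successors satisfy not \<open>a\<close>, the points two steps away satisfy it
  too.\<close>

lemma dia_dia_Grz:
  assumes "normal_logic L" and Grz: "\<And>a. (Box m (Box m (a \<^bold>\<longrightarrow> Box m a) \<^bold>\<longrightarrow> a) \<^bold>\<longrightarrow> a) \<in> L"
  shows "(Dia m (Dia m a) \<^bold>\<longrightarrow> Dia m a) \<in> L"
proof -
  interpret normal_logic L by fact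
  let ?sat = "sat (Collect world) acc canonical_val"
  have refl: "acc m w w" if "world w" for w
    unfolding acc_def using dia_Grz[OF assms] world_L[OF that] world_Imp[OF that] by blast
  show ?thesis
  proof (rule L_worlds)
    fix x assume x: "world x"
    show "(Dia m (Dia m a) \<^bold>\<longrightarrow> Dia m a) \<in> x"
    proof (rule ccontr)
      assume "\<not> ?thesis"
      then have yz: "?sat (Dia m (Dia m a)) x"
        and no: "\<And>y. world y \<Longrightarrow> acc m x y \<Longrightarrow> \<not> ?sat a y"
        unfolding truth[OF x, symmetric] by auto
      let ?b = "\<^bold>\<not> a"
      let ?c = "?b \<^bold>\<and> (Box m ?b \<^bold>\<longrightarrow> Box m (Box m ?b))"
      \<comment> \<open>If \<open>?c\<close> fails at \<open>y\<close>, some successor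
        \<open>z\<close> refutes the box of \<open>?b\<close> while satisfying \<open>?b\<close>.
        There \<open>?c\<close> holds vacuously, so the assumption on \<open>y\<close> makes
        \<open>?c\<close>, and with it \<open>?b\<close>, true at all successors of
        \<open>z\<close>, a contradiction.\<close>
      have c: "?sat ?c y" if y: "world y" "acc m x y" "?sat (Box m (?c \<^bold>\<longrightarrow> Box m ?c)) y" for y
      proof (rule ccontr)
        assume "\<not> ?sat ?c y"
        then have "?sat (Box m ?b) y" "\<not> ?sat (Box m (Box m ?b)) y"
          using no[OF y(1,2)] by auto
        then obtain z where z: "world z" "acc m y z" "\<not> ?sat (Box m ?b) z" "\<not> ?sat a z" by auto
        then have "?sat (?c \<^bold>\<longrightarrow> Box m ?c) z" "?sat ?c z" using y(3) by auto
        then have "?sat (Box m ?c) z" by (rule sat_ImpD)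
        then have "?sat (Box m ?b) z" by auto
        then show False using z by blast
      qed
      have "?sat (Box m (Box m (?c \<^bold>\<longrightarrow> Box m ?c) \<^bold>\<longrightarrow> ?c)) x"
      proof (rule iffD2[OF sat_Box], intro ballI impI, rule sat_ImpI)
        fix v assume v: "v \<in> Collect world" "acc m x v" "?sat (Box m (?c \<^bold>\<longrightarrow> Box m ?c)) v"
        show "?sat ?c v" by (rule c[OF _ v(2,3)]) (use v(1) in \<open>simp only: mem_Collect_eq\<close>)
      qed
      then have "?sat ?c x"
        by (rule sat_ImpD[OF canonical_sound[OF x Grz]])
      then show False using yz no by auto
    qed
  qed
qed

subsection \<open>Thinning out the canonical model\<close>

context commuting_frame
begin

text \<open>This is accessibility between \<open>E\<close>-clusters: by commutation it depends only
  on the clusters of its two arguments, and composing \<open>E\<close> with \<open>R\<close> in the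
  other order gives the same relation.\<close>

definition above :: "'w \<Rightarrow> 'w \<Rightarrow> bool" where
  "above x y \<longleftrightarrow> (\<exists>u\<in>W. R x u \<and> E u y)"

lemma above_R: "y \<in> W \<Longrightarrow> R x y \<Longrightarrow> above x y"
  unfolding above_def using E_refl[of y] by blast

lemma above_E: "y \<in> W \<Longrightarrow> z \<in> W \<Longrightarrow> above x y \<Longrightarrow> E y z \<Longrightarrow> above x z"
  unfolding above_def using E_trans[of _ y z] by blast

lemma E_above:
  assumes "x \<in> W" "y \<in> W" "z \<in> W" "E x y" "above y z"
  shows "above x z"
proof -
  obtain v where v: "v \<in> W" "R y v" "E v z" using assms unfolding above_def by blast
  obtain u where "u \<in> W" "R x u" "E u v" using ER_RE[OF assms(1,2) v(1) assms(4) v(2)] by blast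
  then show ?thesis unfolding above_def using E_trans[of u v z] v assms(3) by blast
qed

lemma above_trans:
  assumes "x \<in> W" "y \<in> W" "z \<in> W" "above x y" "above y z"
  shows "above x z"
proof -
  obtain u where u: "u \<in> W" "R x u" "E u y" using assms(4) unfolding above_def by blast
  obtain v where v: "v \<in> W" "R u v" "E v z"
    using E_above[OF u(1) assms(2,3) u(3) assms(5)] unfolding above_def by blast
  have "R x v" using R_trans[OF assms(1) u(1) v(1) u(2) v(2)] .
  then show ?thesis unfolding above_def using v by blast
qed

lemma above_back:
  assumes "x \<in> W" "y \<in> W" "above x y"
  obtains u where "u \<in> W" "E x u" "R u y"
proof -
  obtain v where v: "v \<in> W" "R x v" "E v y" using assms unfolding above_def by blast
  show thesis using RE_ER[OF assms(1) v(1) assms(2) v(2,3)] that by blast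
qed

end

section \<open>Types, definable sets and submodels for a finite set of formulae\<close>

locale finite_language = commuting_frame W R E for W :: "'w set" and R E +
  fixes V :: "nat \<Rightarrow> 'w \<Rightarrow> bool" and S :: "modality fm set"
  assumes finite_S: "finite S"
    and S_Imp: "(\<phi> \<^bold>\<longrightarrow> \<psi>) \<in> S \<Longrightarrow> \<phi> \<in> S \<and> \<psi> \<in> S"
    and S_Dia: "Dia m \<phi> \<in> S \<Longrightarrow> \<phi> \<in> S"
begin

abbreviation holds :: "modality fm \<Rightarrow> 'w \<Rightarrow> bool" where
  "holds \<equiv> sat W (frel R E) V"

definition type_of :: "'w \<Rightarrow> modality fm set" where
  "type_of x = {\<phi>\<in>S. holds \<phi> x}"

definition cluster_type :: "'w \<Rightarrow> modality fm set set" where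
  "cluster_type x = type_of ` {y\<in>W. E x y}"

text \<open>The condition of the transitive (Lemmon) filtration: asking for
  \<open>Dia Temp \<psi>\<close> to be inherited backwards makes it transitive, and it depends only
  on the types of the two points.\<close>

definition fits :: "'w \<Rightarrow> 'w \<Rightarrow> bool" where
  "fits x y \<longleftrightarrow> (\<forall>\<psi>. Dia Temp \<psi> \<in> S \<longrightarrow> holds \<psi> y \<or> holds (Dia Temp \<psi>) y \<longrightarrow> holds (Dia Temp \<psi>) x)"

lemma fits_trans: "fits x y \<Longrightarrow> fits y z \<Longrightarrow> fits x z"
  unfolding fits_def by blast

lemma fits_R:
  assumes "x \<in> W" "y \<in> W" "R x y"
  shows "fits x y"
  unfolding fits_def using assms R_trans[OF assms(1,2) _ assms(3)] by auto

lemma type_of_eqD: "type_of x = type_of y \<Longrightarrow> \<phi> \<in> S \<Longrightarrow> holds \<phi> x \<longleftrightarrow> holds \<phi> y"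
  unfolding type_of_def by blast

lemma fits_type_right: "fits x y \<Longrightarrow> type_of y = type_of z \<Longrightarrow> fits x z"
  unfolding fits_def using type_of_eqD[of y z] S_Dia by blast

lemma fits_type_left: "fits x y \<Longrightarrow> type_of x = type_of z \<Longrightarrow> fits z y"
  unfolding fits_def using type_of_eqD[of x z] by blast

lemma cluster_type_E:
  assumes "x \<in> W" "y \<in> W" "E x y"
  shows "cluster_type x = cluster_type y"
proof -
  have "{z\<in>W. E x z} = {z\<in>W. E y z}"
    using assms E_sym[OF assms] E_trans[of x y] E_trans[of y x] by blast
  then show ?thesis unfolding cluster_type_def by simp
qed

lemma type_in_cluster_type: "x \<in> W \<Longrightarrow> type_of x \<in> cluster_type x"
  unfolding cluster_type_def using E_refl[of x] by blast

lemma cluster_typeE: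
  assumes "t \<in> cluster_type x"
  obtains y where "y \<in> W" "E x y" "type_of y = t"
  using assms that unfolding cluster_type_def by blast

lemma cluster_type_subset: "cluster_type x \<subseteq> Pow S"
  unfolding cluster_type_def type_of_def by blast

lemma finite_cluster_type: "finite (cluster_type x)"
  using finite_subset[OF cluster_type_subset] finite_S by simp

text \<open>The defining formula may lie outside \<open>S\<close>. Definable sets are those to which
  instances of the modal axioms can be applied in the canonical model.\<close>

definition definable :: "('w \<Rightarrow> bool) \<Rightarrow> bool" where
  "definable P \<longleftrightarrow> (\<exists>\<phi>. \<forall>x\<in>W. holds \<phi> x \<longleftrightarrow> P x)"

lemma definableI: "(\<And>x. x \<in> W \<Longrightarrow> holds \<phi> x \<longleftrightarrow> P x) \<Longrightarrow> definable P"
  unfolding definable_def by blast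

lemma definable_holds: "definable (holds \<phi>)"
  by (rule definableI) simp

lemma definable_not:
  assumes "definable P" shows "definable (\<lambda>x. \<not> P x)"
proof -
  obtain \<phi> where "\<forall>x\<in>W. holds \<phi> x \<longleftrightarrow> P x" using assms unfolding definable_def by blast
  then show ?thesis by (intro definableI[of "\<^bold>\<not> \<phi>"]) simp
qed

lemma definable_conj:
  assumes "definable P" "definable Q" shows "definable (\<lambda>x. P x \<and> Q x)"
proof -
  obtain \<phi> where "\<forall>x\<in>W. holds \<phi> x \<longleftrightarrow> P x" using assms unfolding definable_def by blast
  moreover obtain \<psi> where "\<forall>x\<in>W. holds \<psi> x \<longleftrightarrow> Q x" using assms unfolding definable_def by blast
  ultimately show ?thesis by (intro definableI[of "\<phi> \<^bold>\<and> \<psi>"]) simp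
qed

lemma definable_True: "definable (\<lambda>x. True)"
  by (rule definableI[of "\<^bold>\<not> Falsum"]) simp

lemma definable_iff:
  assumes "definable P" shows "definable (\<lambda>x. P x \<longleftrightarrow> c)"
  using assms definable_not[OF assms] by (cases c) simp_all

lemma definable_const: "definable (\<lambda>x. c)"
  using definable_True definable_not[OF definable_True] by (cases c) simp_all

lemma definable_Ball:
  assumes "finite F" "\<And>i. definable (P i)"
  shows "definable (\<lambda>x. \<forall>i\<in>F. P i x)"
  using assms(1) by induction (simp_all add: definable_True definable_conj assms(2))

lemma definable_E:
  assumes "definable P" shows "definable (\<lambda>x. \<exists>y\<in>W. E x y \<and> P y)"
proof -
  obtain \<phi> where "\<forall>x\<in>W. holds \<phi> x \<longleftrightarrow> P x" using assms unfolding definable_def by blast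
  then show ?thesis by (intro definableI[of "Dia Quant \<phi>"]) simp
qed

lemma definable_type: "definable (\<lambda>x. type_of x = t)"
proof -
  have "(\<lambda>x. type_of x = t) = (\<lambda>x. t \<subseteq> S \<and> (\<forall>\<phi>\<in>S. holds \<phi> x \<longleftrightarrow> \<phi> \<in> t))"
    unfolding type_of_def by (intro ext) blast
  then show ?thesis
    by (simp only:) (intro definable_conj definable_const definable_Ball finite_S definable_iff definable_holds)
qed

text \<open>As \<open>S\<close> is finite, a cluster type is fixed by finitely many facts: for each
  of the possible types, whether some point of the cluster has it.\<close>

lemma definable_cluster_type: "definable (\<lambda>x. cluster_type x = Q)"
proof -
  have "(\<lambda>x. cluster_type x = Q) =
      (\<lambda>x. Q \<subseteq> Pow S \<and> (\<forall>t\<in>Pow S. (\<exists>y\<in>W. E x y \<and> type_of y = t) \<longleftrightarrow> t \<in> Q))"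
  proof (intro ext iffI)
    fix x assume "cluster_type x = Q"
    then show "Q \<subseteq> Pow S \<and> (\<forall>t\<in>Pow S. (\<exists>y\<in>W. E x y \<and> type_of y = t) \<longleftrightarrow> t \<in> Q)"
      using cluster_type_subset[of x] unfolding cluster_type_def by blast
  next
    fix x assume *: "Q \<subseteq> Pow S \<and> (\<forall>t\<in>Pow S. (\<exists>y\<in>W. E x y \<and> type_of y = t) \<longleftrightarrow> t \<in> Q)"
    have mem: "t \<in> cluster_type x \<longleftrightarrow> (t \<in> Pow S \<and> (\<exists>y\<in>W. E x y \<and> type_of y = t))" for t
      using cluster_type_subset[of x] unfolding cluster_type_def by blast
    have "t \<in> cluster_type x \<longleftrightarrow> t \<in> Q" for t
      using mem[of t] conjunct1[OF *] bspec[OF conjunct2[OF *], of t] by blast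
    then show "cluster_type x = Q" by (rule set_eqI)
  qed
  then show ?thesis
    by (simp only:)
      (intro definable_conj definable_const definable_Ball finite_S finite_Pow_iff[THEN iffD2]
        definable_iff definable_E definable_type)
qed

text \<open>\<open>Q\<close> need not be contained in \<open>R\<close>: since \<open>Q\<close>-related points fit each other, a witness for
  \<open>Dia Temp \<psi>\<close> may be replaced by any \<open>Q\<close>-successor of the same type.\<close>

lemma sat_submodel:
  assumes sub: "W' \<subseteq> W"
    and fits: "\<And>x y. x \<in> W' \<Longrightarrow> y \<in> W' \<Longrightarrow> Q x y \<Longrightarrow> fits x y"
    and R_wit: "\<And>x y. x \<in> W' \<Longrightarrow> y \<in> W \<Longrightarrow> R x y \<Longrightarrow> \<exists>z\<in>W'. Q x z \<and> type_of z = type_of y"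
    and E_wit: "\<And>x y. x \<in> W' \<Longrightarrow> y \<in> W \<Longrightarrow> E x y \<Longrightarrow> \<exists>z\<in>W'. E x z \<and> type_of z = type_of y"
  shows "x \<in> W' \<Longrightarrow> \<phi> \<in> S \<Longrightarrow> sat W' (frel Q E) V \<phi> x \<longleftrightarrow> holds \<phi> x"
proof (induction \<phi> arbitrary: x)
  case (Imp \<phi> \<psi>)
  then show ?case using S_Imp[of \<phi> \<psi>] by simp
next
  case (Dia m \<phi>)
  have S: "\<phi> \<in> S" using S_Dia Dia.prems(2) by blast
  have IH: "y \<in> W' \<Longrightarrow> sat W' (frel Q E) V \<phi> y \<longleftrightarrow> holds \<phi> y" for y using Dia.IH S by blast
  show ?case
  proof (cases m)
    case Temp
    show ?thesis
    proof
      assume "sat W' (frel Q E) V (Dia m \<phi>) x"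
      then obtain y where "y \<in> W'" "Q x y" "holds \<phi> y" using IH Temp by auto
      then show "holds (Dia m \<phi>) x"
        using fits[of x y] Dia.prems Temp unfolding fits_def by blast
    next
      assume "holds (Dia m \<phi>) x"
      then obtain y where "y \<in> W" "R x y" "holds \<phi> y" using Temp by auto
      then obtain z where "z \<in> W'" "Q x z" "holds \<phi> z"
        using R_wit[of x y] Dia.prems(1) type_of_eqD[OF _ S] by metis
      then show "sat W' (frel Q E) V (Dia m \<phi>) x" using IH Temp by auto
    qed
  next
    case Quant
    show ?thesis
    proof
      assume "sat W' (frel Q E) V (Dia m \<phi>) x"
      then show "holds (Dia m \<phi>) x" using IH Quant sub by auto
    next
      assume "holds (Dia m \<phi>) x"
      then obtain y where "y \<in> W" "E x y" "holds \<phi> y" using Quant by auto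
      then obtain z where "z \<in> W'" "E x z" "holds \<phi> z"
        using E_wit[of x y] Dia.prems(1) type_of_eqD[OF _ S] by metis
      then show "sat W' (frel Q E) V (Dia m \<phi>) x" using IH Quant by auto
    qed
  qed
qed simp_all

text \<open>Counting cluster types instead of points gives a bound depending on \<open>S\<close>
  alone, even when a point has infinitely many successors.\<close>

definition rank :: "'w set \<Rightarrow> ('w \<Rightarrow> 'w \<Rightarrow> bool) \<Rightarrow> 'w \<Rightarrow> nat" where
  "rank W' Q x = card (cluster_type ` {z\<in>W'. Q x z})"

lemma finite_cluster_types: "finite (cluster_type ` A)"
  by (rule finite_subset[of _ "Pow (Pow S)"]) (use cluster_type_subset finite_S in auto)

lemma rank_bound: "rank W' Q x \<le> card (Pow (Pow S))"
  unfolding rank_def by (rule card_mono) (use cluster_type_subset finite_S in auto)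

lemma rank_less:
  assumes "\<And>z. z \<in> W' \<Longrightarrow> Q y z \<Longrightarrow> Q x z"
    and "v \<in> W'" "Q x v" "\<And>z. z \<in> W' \<Longrightarrow> Q y z \<Longrightarrow> cluster_type z \<noteq> cluster_type v"
  shows "rank W' Q y < rank W' Q x"
  unfolding rank_def
proof (rule psubset_card_mono[OF finite_cluster_types psubsetI])
  show "cluster_type ` {z\<in>W'. Q y z} \<subseteq> cluster_type ` {z\<in>W'. Q x z}" using assms(1) by blast
  have "cluster_type v \<in> cluster_type ` {z\<in>W'. Q x z}" using assms(2,3) by blast
  moreover have "cluster_type v \<notin> cluster_type ` {z\<in>W'. Q y z}" using assms(4) by fastforce
  ultimately show "cluster_type ` {z\<in>W'. Q y z} \<noteq> cluster_type ` {z\<in>W'. Q x z}" by blast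
qed

end

section \<open>Thinned models for MGLB\<close>

locale GL_model = finite_language W R E V S
  for W :: "'w set" and R E and V :: "nat \<Rightarrow> 'w \<Rightarrow> bool" and S +
  assumes loeb: "definable P \<Longrightarrow> x \<in> W \<Longrightarrow> y \<in> W \<Longrightarrow> R x y \<Longrightarrow> P y \<Longrightarrow>
    \<exists>z\<in>W. R x z \<and> P z \<and> (\<forall>u\<in>W. R z u \<longrightarrow> \<not> P u)"
begin

definition core :: "'w set" where
  "core = {x\<in>W. \<forall>z\<in>W. R x z \<longrightarrow> cluster_type z \<noteq> cluster_type x}"

definition new_R :: "'w \<Rightarrow> 'w \<Rightarrow> bool" where
  "new_R x y \<longleftrightarrow> above x y \<and> fits x y"

lemma core_W: "x \<in> core \<Longrightarrow> x \<in> W"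
  unfolding core_def by blast

lemma core_above:
  assumes "x \<in> core" "y \<in> W" "above x y"
  shows "cluster_type y \<noteq> cluster_type x"
proof -
  obtain u where u: "u \<in> W" "R x u" "E u y" using assms(3) unfolding above_def by blast
  then show ?thesis using cluster_type_E[of u y] assms(1,2) unfolding core_def by auto
qed

text \<open>\<open>core\<close> is a union of clusters: an \<open>R\<close>-step from one point of a
  cluster leads to a cluster above all its points. Witnesses for \<open>E\<close> therefore survive
  the thinning unchanged.\<close>

lemma core_E:
  assumes "x \<in> core" "y \<in> W" "E x y"
  shows "y \<in> core"
proof -
  have x: "x \<in> W" using core_W[OF assms(1)] .
  have "cluster_type z \<noteq> cluster_type y" if z: "z \<in> W" "R y z" for z
  proof -
    have "above x z" using E_above[OF x assms(2) z(1) assms(3) above_R[OF z]] .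
    then show ?thesis
      using core_above[OF assms(1) z(1)] cluster_type_E[OF x assms(2,3)] by simp
  qed
  then show ?thesis unfolding core_def using assms(2) by blast
qed

text \<open>\<open>loeb\<close> supplies a last point with the cluster type of \<open>y\<close>. Its
  own type may differ from that of \<open>y\<close>, but equality of the cluster types provides a
  point of the right type in the same cluster.\<close>

lemma core_representative:
  assumes y: "y \<in> W"
  obtains z where "z \<in> core" "type_of z = type_of y" "cluster_type z = cluster_type y"
    "z = y \<or> above y z"
proof (cases "y \<in> core")
  case True
  then show thesis using that by blast
next
  case False
  then obtain w where w: "w \<in> W" "R y w" "cluster_type w = cluster_type y"
    unfolding core_def using y by blast
  obtain z where z: "z \<in> W" "R y z" "cluster_type z = cluster_type y"
      "\<forall>u\<in>W. R z u \<longrightarrow> cluster_type u \<noteq> cluster_type y"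
    using loeb[OF definable_cluster_type[of "cluster_type y"] y w] by blast
  have zc: "z \<in> core" unfolding core_def using z(1,3,4) by simp
  have "type_of y \<in> cluster_type z" using type_in_cluster_type[OF y] z(3) by simp
  then obtain v where v: "v \<in> W" "E z v" "type_of v = type_of y" by (rule cluster_typeE)
  have "cluster_type v = cluster_type y" using cluster_type_E[OF z(1) v(1,2)] z(3) by simp
  moreover have "above y v" unfolding above_def using z v by blast
  ultimately show thesis using that[of v] core_E[OF zc v(1,2)] v(3) by blast
qed

lemma new_R_trans:
  assumes "x \<in> core" "y \<in> core" "z \<in> core" "new_R x y" "new_R y z"
  shows "new_R x z"
  using assms(4,5) above_trans[OF assms(1-3)[THEN core_W]] fits_trans[of x y z]
  unfolding new_R_def by blast

lemma ranked_frame_core: "ranked_frame core new_R E (rank core new_R)"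
proof
  fix x y z assume xyz: "x \<in> core" "y \<in> core" "z \<in> core"
  note W = xyz[THEN core_W]
  show "E x y \<Longrightarrow> E y z \<Longrightarrow> E x z" using E_trans[OF W] .
  show "new_R x y \<Longrightarrow> new_R y z \<Longrightarrow> new_R x z" using new_R_trans[OF xyz] .
  show "\<exists>u\<in>core. new_R x u \<and> E u z" if "E x y" "new_R y z"
  proof -
    have "above x z" using E_above[OF W that(1)] that(2) unfolding new_R_def by blast
    \<comment> \<open>The witness is a genuine \<open>R\<close>-successor of \<open>x\<close> in the
      cluster of \<open>z\<close>, so \<open>fits\<close> comes from \<open>R\<close>, and
      membership in \<open>core\<close> from closure under \<open>E\<close>.\<close>
    then obtain u where u: "u \<in> W" "R x u" "E u z" unfolding above_def by blast
    have "u \<in> core" using core_E[OF xyz(3) u(1) E_sym[OF u(1) W(3) u(3)]] .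
    moreover have "new_R x u"
      unfolding new_R_def using above_R[OF u(1,2)] fits_R[OF W(1) u(1,2)] by blast
    ultimately show ?thesis using u(3) by blast
  qed
  show "\<exists>u\<in>core. E x u \<and> new_R u z" if "new_R x y" "E y z"
  proof -
    have "above x z" using above_E[OF W(2,3) _ that(2)] that(1) unfolding new_R_def by blast
    then obtain u where u: "u \<in> W" "E x u" "R u z" using above_back[OF W(1,3)] by blast
    have "new_R u z"
      unfolding new_R_def using above_R[OF W(3) u(3)] fits_R[OF u(1) W(3) u(3)] by blast
    then show ?thesis using core_E[OF xyz(1) u(1,2)] u(2) by blast
  qed
next
  fix x y assume xy: "x \<in> core" "y \<in> core"
  note W = xy[THEN core_W]
  show "E x y \<Longrightarrow> E y x" using E_sym[OF W] .
  assume "new_R x y"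
  moreover from this have "new_R x z" if "z \<in> core" "new_R y z" for z
    using new_R_trans[OF xy that(1) _ that(2)] by blast
  moreover have "cluster_type z \<noteq> cluster_type y" if "z \<in> core" "new_R y z" for z
    using core_above[OF xy(2) core_W[OF that(1)]] that(2) unfolding new_R_def by blast
  \<comment> \<open>The cluster type lost in the step is that of \<open>y\<close>: it is visible
    from \<open>x\<close>, but not from \<open>y\<close> itself.\<close>
  ultimately show "rank core new_R y < rank core new_R x" using xy(2) by (intro rank_less) 
next
  fix x assume "x \<in> core"
  then show "E x x" using E_refl core_W by blast
qed

lemma sat_core: "x \<in> core \<Longrightarrow> \<phi> \<in> S \<Longrightarrow> sat core (frel new_R E) V \<phi> x \<longleftrightarrow> holds \<phi> x"
proof (rule sat_submodel)
  show "core \<subseteq> W" using core_W by blast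
  show "fits x y" if "new_R x y" for x y using that unfolding new_R_def by blast
next
  fix x y assume x: "x \<in> core" and y: "y \<in> W" and xy: "R x y"
  note xW = core_W[OF x]
  obtain z where z: "z \<in> core" "type_of z = type_of y" "z = y \<or> above y z"
    using core_representative[OF y] by metis
  have "above x z"
    using z(3) above_R[OF y xy] above_trans[OF xW y core_W[OF z(1)] above_R[OF y xy]] by blast
  moreover have "fits x z" using fits_type_right[OF fits_R[OF xW y xy] z(2)[symmetric]] .
  ultimately show "\<exists>z\<in>core. new_R x z \<and> type_of z = type_of y"
    unfolding new_R_def using z by blast
next
  fix x y assume "x \<in> core" "y \<in> W" "E x y"
  then show "\<exists>z\<in>core. E x z \<and> type_of z = type_of y" using core_E by blast
qed

theorem bounded_depth_refutation:
  assumes "x \<in> W" "\<phi> \<in> S" "\<not> holds \<phi> x"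
  shows "\<exists>n\<ge>1. \<phi> \<notin> MGLB\<lbrakk>n\<rbrakk>"
proof -
  interpret new: ranked_frame core new_R E "rank core new_R" by (rule ranked_frame_core)
  \<comment> \<open>The successor turns the bound on the rank into the strict inequality required by
    \<open>with_depth_valid\<close>, and ensures that the depth is at least 1.\<close>
  let ?n = "Suc (card (Pow (Pow S)))"
  have "\<not> new_R y y" if "y \<in> core" for y
    using core_above[OF that core_W[OF that]] unfolding new_R_def by blast
  then have "MGLB\<lbrakk>?n\<rbrakk> \<subseteq> valid core (frel new_R E)"
    unfolding MGLB_def
    by (intro new.with_depth_valid new.MB_valid new.GL_valid) (auto simp: less_Suc_eq_le rank_bound)
  moreover obtain y where "y \<in> core" "type_of y = type_of x"
    using core_representative[OF assms(1)] by metis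
  moreover from this have "\<not> sat core (frel new_R E) V \<phi> y"
    using sat_core[of y \<phi>] type_of_eqD[of y x \<phi>] assms(2,3) by blast
  ultimately have "\<phi> \<notin> MGLB\<lbrakk>?n\<rbrakk>" unfolding valid_def by blast
  then show ?thesis by (intro exI[of _ ?n]) simp
qed

end

section \<open>Thinned models for M+GrzB\<close>

text \<open>In the models of \<open>MplusGrzB\<close> a cluster type \<open>Q\<close> may recur along \<open>R\<close>, so \<open>R\<close>-successors with the
  same cluster type cannot be discarded. The Casari-type axiom gives, for every type \<open>t\<close> in \<open>Q\<close>, a
  steady point of type \<open>t\<close>: all its \<open>R\<close>-successors with cluster type \<open>Q\<close> have type \<open>t\<close> as well,
  and it may act as their representative itself.\<close>

locale MplusGrz_model = finite_language W R E V S
  for W :: "'w set" and R E and V :: "nat \<Rightarrow> 'w \<Rightarrow> bool" and S +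
  assumes R_refl: "x \<in> W \<Longrightarrow> R x x"
    and grz: "definable P \<Longrightarrow> x \<in> W \<Longrightarrow> P x \<Longrightarrow>
      \<exists>y\<in>W. R x y \<and> P y \<and> (\<forall>u\<in>W. \<forall>v\<in>W. R y u \<longrightarrow> \<not> P u \<longrightarrow> R u v \<longrightarrow> \<not> P v)"
    and casari: "definable P \<Longrightarrow> x \<in> W \<Longrightarrow> y \<in> W \<Longrightarrow> above x y \<Longrightarrow> P y \<Longrightarrow>
      \<exists>z\<in>W. above x z \<and> P z \<and>
        (\<forall>u\<in>W. \<forall>v\<in>W. R z u \<longrightarrow> above u v \<longrightarrow> P v \<longrightarrow> (\<exists>w\<in>W. R u w \<and> P w))"
begin

text \<open>Reflexivity rules out a last point in the strict sense. The substitute is that the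
  cluster type may persist upwards but, once left, never returns.\<close>

definition maximal :: "'w \<Rightarrow> bool" where
  "maximal x \<longleftrightarrow> (\<forall>u\<in>W. \<forall>v\<in>W. above x u \<longrightarrow> above u v \<longrightarrow>
    cluster_type v = cluster_type x \<longrightarrow> cluster_type u = cluster_type x)"

definition steady :: "'w \<Rightarrow> bool" where
  "steady x \<longleftrightarrow> (\<forall>u\<in>W. R x u \<longrightarrow> cluster_type u = cluster_type x \<longrightarrow> type_of u = type_of x)"

definition steady_type :: "'w \<Rightarrow> modality fm set \<Rightarrow> bool" where
  "steady_type x t \<longleftrightarrow> (\<exists>y\<in>W. E x y \<and> type_of y = t \<and> steady y)"

definition core :: "'w set" where
  "core = {x\<in>W. maximal x \<and> (\<forall>t\<in>cluster_type x. steady_type x t) \<and> steady x}"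

text \<open>Demanding different cluster types for distinct related points keeps them out of a common
  cluster, which is the \<open>clean\<close> condition needed for soundness of the Casari-type
  axiom.\<close>

definition new_R :: "'w \<Rightarrow> 'w \<Rightarrow> bool" where
  "new_R x y \<longleftrightarrow> x = y \<or> (above x y \<and> cluster_type x \<noteq> cluster_type y \<and> fits x y)"

lemma above_refl: "x \<in> W \<Longrightarrow> above x x"
  using above_R[of x x] R_refl by blast

lemma core_W: "x \<in> core \<Longrightarrow> x \<in> W"
  unfolding core_def by blast

lemma maximal_above:
  assumes "x \<in> W" "y \<in> W" "above x y" "cluster_type y = cluster_type x" "maximal x"
  shows "maximal y"
proof -
  have "above x u" if "u \<in> W" "above y u" for u using above_trans[OF assms(1,2) that(1) assms(3) that(2)] .
  then show ?thesis using assms(4,5) unfolding maximal_def by metis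
qed

lemma steady_R:
  assumes "x \<in> W" "y \<in> W" "R x y" "cluster_type y = cluster_type x" "steady x"
  shows "steady y \<and> type_of y = type_of x"
proof -
  have "type_of y = type_of x" using assms(2-5) unfolding steady_def by blast
  moreover have "R x u" if "u \<in> W" "R y u" for u using R_trans[OF assms(1,2) that(1) assms(3) that(2)] .
  ultimately show ?thesis using assms(4,5) unfolding steady_def by metis
qed

text \<open>The steady point \<open>v\<close> in the cluster of \<open>x\<close> has, by
  commutation, an \<open>R\<close>-successor in the cluster of \<open>y\<close>; since the cluster
  type is unchanged, steadiness carries the type \<open>t\<close> along.\<close>

lemma steady_type_above:
  assumes "x \<in> W" "y \<in> W" "above x y" "cluster_type y = cluster_type x" "steady_type x t"
  shows "steady_type y t"
proof -
  obtain v where v: "v \<in> W" "E x v" "type_of v = t" "steady v"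
    using assms(5) unfolding steady_type_def by blast
  have "above v y" using E_above[OF v(1) assms(1,2) E_sym[OF assms(1) v(1,2)] assms(3)] .
  then obtain u where u: "u \<in> W" "R v u" "E u y" unfolding above_def by blast
  have "cluster_type u = cluster_type v"
    using cluster_type_E[OF u(1) assms(2) u(3)] cluster_type_E[OF assms(1) v(1,2)] assms(4) by simp
  then have "steady u \<and> type_of u = t" using steady_R[OF v(1) u(1,2) _ v(4)] v(3) by simp
  then show ?thesis unfolding steady_type_def using u E_sym[OF u(1) assms(2) u(3)] by blast
qed

lemma exists_maximal:
  assumes "x \<in> W"
  obtains y where "y \<in> W" "above x y" "cluster_type y = cluster_type x" "maximal y"
proof -
  obtain y where y: "y \<in> W" "R x y" "cluster_type y = cluster_type x" and
    max: "\<forall>u\<in>W. \<forall>v\<in>W. R y u \<longrightarrow> cluster_type u \<noteq> cluster_type x \<longrightarrow> R u v \<longrightarrow> cluster_type v \<noteq> cluster_type x"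
    using grz[OF definable_cluster_type[of "cluster_type x"] assms refl] by blast
  \<comment> \<open>\<open>grz\<close> controls only \<open>R\<close>-paths. A path through clusters
    is lifted to an \<open>R\<close>-path from \<open>y\<close> by commutation, with the same
    cluster types.\<close>
  have "cluster_type u = cluster_type y"
    if uv: "u \<in> W" "v \<in> W" "above y u" "above u v" "cluster_type v = cluster_type y" for u v
  proof -
    obtain u' where u': "u' \<in> W" "R y u'" "E u' u" using uv(3) unfolding above_def by blast
    have "above u' v" using E_above[OF u'(1) uv(1,2) u'(3) uv(4)] .
    then obtain v' where v': "v' \<in> W" "R u' v'" "E v' v" unfolding above_def by blast
    have "cluster_type v' = cluster_type x"
      using cluster_type_E[OF v'(1) uv(2) v'(3)] uv(5) y(3) by simp
    then have "cluster_type u' = cluster_type x" using max u'(1,2) v'(1,2) by blast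
    then show ?thesis using cluster_type_E[OF u'(1) uv(1) u'(3)] y(3) by simp
  qed
  then have "maximal y" unfolding maximal_def by blast
  then show thesis using that[of y] y above_R[OF y(1,2)] by blast
qed

text \<open>\<open>casari\<close> gives a point \<open>z\<close> beyond which every point with a
  \<open>?P\<close>-point in a cluster above it also \<open>R\<close>-sees a
  \<open>?P\<close>-point. \<open>grz\<close> then gives \<open>y\<close> beyond \<open>z\<close>
  after which \<open>?P\<close>, once lost, is lost along \<open>R\<close>. An
  \<open>R\<close>-successor of \<open>y\<close> of the same cluster type has \<open>t\<close> in
  its cluster, so it still sees \<open>?P\<close> and hence satisfies it.\<close>

lemma exists_steady:
  assumes x: "x \<in> W" and t: "t \<in> cluster_type x"
  obtains y where "y \<in> W" "above x y" "cluster_type y = cluster_type x" "type_of y = t" "steady y"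
proof -
  let ?P = "\<lambda>v. type_of v = t \<and> cluster_type v = cluster_type x"
  have P: "definable ?P" by (intro definable_conj definable_type definable_cluster_type)
  obtain x' where x': "x' \<in> W" "E x x'" "type_of x' = t" using t by (rule cluster_typeE)
  have "above x x'" using above_E[OF x x'(1) above_refl[OF x] x'(2)] .
  moreover have "?P x'" using x'(3) cluster_type_E[OF x x'(1,2)] by simp
  ultimately obtain z where z: "z \<in> W" "above x z" "?P z" and
    ret: "\<forall>u\<in>W. \<forall>v\<in>W. R z u \<longrightarrow> above u v \<longrightarrow> ?P v \<longrightarrow> (\<exists>w\<in>W. R u w \<and> ?P w)"
    using casari[OF P x x'(1)] by blast
  obtain y where y: "y \<in> W" "R z y" "?P y" and
    max: "\<forall>u\<in>W. \<forall>v\<in>W. R y u \<longrightarrow> \<not> ?P u \<longrightarrow> R u v \<longrightarrow> \<not> ?P v"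
    using grz[OF P z(1,3)] by blast
  have "type_of u = t" if u: "u \<in> W" "R y u" "cluster_type u = cluster_type x" for u
  proof -
    have "t \<in> cluster_type u" using t u(3) by simp
    then obtain v where v: "v \<in> W" "E u v" "type_of v = t" by (rule cluster_typeE)
    have "?P v" using v(3) cluster_type_E[OF u(1) v(1,2)] u(3) by simp
    moreover have "above u v" using above_E[OF u(1) v(1) above_refl[OF u(1)] v(2)] .
    moreover have "R z u" using R_trans[OF z(1) y(1) u(1) y(2) u(2)] .
    ultimately obtain w where "w \<in> W" "R u w" "?P w" using ret u(1) v(1) by blast
    then show ?thesis using max u(1,2) by blast
  qed
  then have "steady y" unfolding steady_def using y(3) by simp
  moreover have "above x y" using above_trans[OF x z(1) y(1) z(2) above_R[OF y(1,2)]] .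
  ultimately show thesis using that[of y] y by blast
qed

text \<open>The types are made steady one at a time; moving further up within the same cluster type
  keeps those already achieved, by \<open>steady_type_above\<close>.\<close>

lemma exists_steady_types:
  assumes x: "x \<in> W" and T: "finite T" "T \<subseteq> cluster_type x"
  shows "\<exists>y\<in>W. above x y \<and> cluster_type y = cluster_type x \<and> (\<forall>t\<in>T. steady_type y t)"
  using T
proof induction
  case empty
  then show ?case using x above_refl by blast
next
  case (insert t T)
  then obtain y where y: "y \<in> W" "above x y" "cluster_type y = cluster_type x" "\<forall>t\<in>T. steady_type y t"
    by blast
  have "t \<in> cluster_type y" using insert.prems y(3) by blast
  then obtain z where z: "z \<in> W" "above y z" "cluster_type z = cluster_type y" "type_of z = t" "steady z"
    using exists_steady[OF y(1)] by blast
  have "steady_type z t" unfolding steady_type_def using z E_refl by blast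
  moreover have "steady_type z s" if "s \<in> T" for s
    using steady_type_above[OF y(1) z(1-3)] y(4) that by blast
  moreover have "above x z" using above_trans[OF x y(1) z(1) y(2) z(2)] .
  ultimately show ?case using z y(3) by (intro bexI[of _ z]) auto
qed

text \<open>\<open>core\<close> need not be a union of clusters, since unsteady points are dropped.
  It still contains a point of every type occurring in the cluster, which is enough for truth and
  for commutation.\<close>

lemma core_E_representative:
  assumes "x \<in> core" "y \<in> W" "E x y"
  obtains z where "z \<in> core" "E x z" "type_of z = type_of y"
proof -
  have x: "x \<in> W" "maximal x" "\<forall>t\<in>cluster_type x. steady_type x t" using assms(1) unfolding core_def by auto
  have "type_of y \<in> cluster_type x"
    using type_in_cluster_type[OF assms(2)] cluster_type_E[OF x(1) assms(2,3)] by simp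
  then obtain z where z: "z \<in> W" "E x z" "type_of z = type_of y" "steady z"
    using x(3) unfolding steady_type_def by blast
  have eq: "cluster_type z = cluster_type x" using cluster_type_E[OF x(1) z(1,2)] by simp
  have xz: "above x z" using above_E[OF x(1) z(1) above_refl[OF x(1)] z(2)] .
  have "maximal z" using maximal_above[OF x(1) z(1) xz eq x(2)] .
  moreover have "\<forall>t\<in>cluster_type z. steady_type z t"
    using steady_type_above[OF x(1) z(1) xz eq] x(3) eq by simp
  ultimately have "z \<in> core" unfolding core_def using z by blast
  then show thesis using that z by blast
qed

lemma core_representative:
  assumes y: "y \<in> W"
  obtains z where "z \<in> core" "type_of z = type_of y" "cluster_type z = cluster_type y" "above y z"
proof -
  obtain a where a: "a \<in> W" "above y a" "cluster_type a = cluster_type y" "maximal a"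
    using exists_maximal[OF y] by blast
  obtain b where b: "b \<in> W" "above a b" "cluster_type b = cluster_type a"
    "\<forall>t\<in>cluster_type a. steady_type b t"
    using exists_steady_types[OF a(1) finite_cluster_type subset_refl] by blast
  have max: "maximal b" using maximal_above[OF a(1) b(1-3) a(4)] .
  have "type_of y \<in> cluster_type a" using type_in_cluster_type[OF y] a(3) by simp
  then obtain z where z: "z \<in> W" "E b z" "type_of z = type_of y" "steady z"
    using b(4) unfolding steady_type_def by blast
  have eq: "cluster_type z = cluster_type b" using cluster_type_E[OF b(1) z(1,2)] by simp
  have bz: "above b z" using above_E[OF b(1) z(1) above_refl[OF b(1)] z(2)] .
  have "maximal z" using maximal_above[OF b(1) z(1) bz eq max] .
  moreover have "\<forall>t\<in>cluster_type z. steady_type z t"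
    using steady_type_above[OF b(1) z(1) bz eq] b(3,4) eq by simp
  ultimately have "z \<in> core" unfolding core_def using z by blast
  moreover have "above y z"
    using above_trans[OF y b(1) z(1) above_trans[OF y a(1) b(1) a(2) b(2)] bz] .
  ultimately show thesis using that[of z] z(3) eq b(3) a(3) by simp
qed

lemma core_above_above:
  assumes "x \<in> core" "y \<in> W" "z \<in> W" "above x y" "above y z" "cluster_type x \<noteq> cluster_type y"
  shows "cluster_type z \<noteq> cluster_type x"
  using assms unfolding core_def maximal_def by auto

lemma new_R_trans:
  assumes "x \<in> core" "y \<in> core" "z \<in> core" "new_R x y" "new_R y z"
  shows "new_R x z"
proof (cases "x = y \<or> y = z")
  case True
  then show ?thesis using assms(4,5) by blast
next
  case False
  note W = assms(1-3)[THEN core_W]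
  have xy: "above x y" "cluster_type x \<noteq> cluster_type y" "fits x y"
    and yz: "above y z" "fits y z"
    using False assms(4,5) unfolding new_R_def by blast+
  show ?thesis
    unfolding new_R_def
    using above_trans[OF W xy(1) yz(1)] core_above_above[OF assms(1) W(2,3) xy(1) yz(1) xy(2)]
      fits_trans[OF xy(3) yz(2)] by simp
qed

lemma ranked_frame_core: "ranked_frame core new_R E (rank core new_R)"
proof
  fix x y z assume xyz: "x \<in> core" "y \<in> core" "z \<in> core"
  note W = xyz[THEN core_W]
  show "E x y \<Longrightarrow> E y z \<Longrightarrow> E x z" using E_trans[OF W] .
  show "new_R x y \<Longrightarrow> new_R y z \<Longrightarrow> new_R x z" using new_R_trans[OF xyz] .
  show "\<exists>u\<in>core. new_R x u \<and> E u z" if "E x y" "new_R y z"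
  proof (cases "y = z")
    case True
    then show ?thesis using xyz that(1) unfolding new_R_def by blast
  next
    case False
    then have yz: "above y z" "cluster_type y \<noteq> cluster_type z" using that(2) unfolding new_R_def by blast+
    have "above x z" using E_above[OF W that(1) yz(1)] .
    then obtain v where v: "v \<in> W" "R x v" "E v z" unfolding above_def by blast
    \<comment> \<open>The \<open>R\<close>-successor \<open>v\<close> may be unsteady and thus
      outside \<open>core\<close>. It is exchanged for a core point of the same cluster and type,
      which \<open>fits\<close> cannot distinguish from it.\<close>
    obtain u where u: "u \<in> core" "E z u" "type_of u = type_of v"
      using core_E_representative[OF xyz(3) v(1) E_sym[OF v(1) W(3) v(3)]] by blast
    note uW = core_W[OF u(1)]
    have "above x u" using above_E[OF W(3) uW \<open>above x z\<close> u(2)] .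
    moreover have "cluster_type x \<noteq> cluster_type u"
      using cluster_type_E[OF W(1,2) that(1)] cluster_type_E[OF W(3) uW u(2)] yz(2) by simp
    moreover have "fits x u" using fits_type_right[OF fits_R[OF W(1) v(1,2)] u(3)[symmetric]] .
    ultimately have "new_R x u" unfolding new_R_def by blast
    then show ?thesis using u(1) E_sym[OF W(3) uW u(2)] by blast
  qed
  show "\<exists>u\<in>core. E x u \<and> new_R u z" if "new_R x y" "E y z"
  proof (cases "x = y")
    case True
    then show ?thesis using xyz that(2) unfolding new_R_def by blast
  next
    case False
    then have xy: "above x y" "cluster_type x \<noteq> cluster_type y" using that(1) unfolding new_R_def by blast+
    have xz: "above x z" using above_E[OF W(2,3) xy(1) that(2)] .
    then obtain v where v: "v \<in> W" "E x v" "R v z" using above_back[OF W(1,3)] by blast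
    obtain u where u: "u \<in> core" "E x u" "type_of u = type_of v"
      using core_E_representative[OF xyz(1) v(1,2)] by blast
    note uW = core_W[OF u(1)]
    have "above u z" using E_above[OF uW W(1,3) E_sym[OF W(1) uW u(2)] xz] .
    moreover have "cluster_type u \<noteq> cluster_type z"
      using cluster_type_E[OF W(2,3) that(2)] cluster_type_E[OF W(1) uW u(2)] xy(2) by simp
    moreover have "fits u z" using fits_type_left[OF fits_R[OF v(1) W(3) v(3)] u(3)[symmetric]] .
    ultimately have "new_R u z" unfolding new_R_def by blast
    then show ?thesis using u by blast
  qed
next
  fix x y assume xy: "x \<in> core" "y \<in> core"
  note W = xy[THEN core_W]
  show "E x y \<Longrightarrow> E y x" using E_sym[OF W] .
  assume R: "new_R x y" and "x \<noteq> y"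
  then have ab: "above x y" "cluster_type x \<noteq> cluster_type y" unfolding new_R_def by blast+
  have "new_R x z" if "z \<in> core" "new_R y z" for z
    using new_R_trans[OF xy that(1) R that(2)] .
  moreover have "cluster_type z \<noteq> cluster_type x" if "z \<in> core" "new_R y z" for z
    using core_above_above[OF xy(1) W(2) core_W[OF that(1)] ab(1) _ ab(2)] that(2) ab(2)
    unfolding new_R_def by auto
  moreover have "new_R x x" unfolding new_R_def by simp
  \<comment> \<open>Here the cluster type lost is that of \<open>x\<close>: \<open>x\<close> sees
    itself, while maximality prevents the cluster type from returning at or above
    \<open>y\<close>.\<close>
  ultimately show "rank core new_R y < rank core new_R x" using xy(1) by (intro rank_less)
next
  fix x assume "x \<in> core"
  then show "E x x" using E_refl core_W by blast
qed

lemma sat_core: "x \<in> core \<Longrightarrow> \<phi> \<in> S \<Longrightarrow> sat core (frel new_R E) V \<phi> x \<longleftrightarrow> holds \<phi> x"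
proof (rule sat_submodel)
  show "core \<subseteq> W" using core_W by blast
  show "fits x y" if "x \<in> core" "new_R x y" for x y
    using that fits_R[of x x] R_refl core_W unfolding new_R_def by blast
next
  fix x y assume x: "x \<in> core" and y: "y \<in> W" and xy: "R x y"
  note xW = core_W[OF x]
  show "\<exists>z\<in>core. new_R x z \<and> type_of z = type_of y"
  proof (cases "cluster_type y = cluster_type x")
    case True
    then have "type_of y = type_of x" using x y xy unfolding core_def steady_def by blast
    then show ?thesis using x unfolding new_R_def by metis
  next
    case False
    obtain z where z: "z \<in> core" "type_of z = type_of y" "cluster_type z = cluster_type y" "above y z"
      using core_representative[OF y] by blast
    have "above x z" using above_trans[OF xW y core_W[OF z(1)] above_R[OF y xy] z(4)] .
    moreover have "fits x z" using fits_type_right[OF fits_R[OF xW y xy] z(2)[symmetric]] .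
    ultimately have "new_R x z" unfolding new_R_def using False z(3) by simp
    then show ?thesis using z by blast
  qed
next
  fix x y assume "x \<in> core" "y \<in> W" "E x y"
  then show "\<exists>z\<in>core. E x z \<and> type_of z = type_of y" using core_E_representative by metis
qed

theorem bounded_depth_refutation:
  assumes "x \<in> W" "\<phi> \<in> S" "\<not> holds \<phi> x"
  shows "\<exists>n\<ge>1. \<phi> \<notin> MplusGrzB\<lbrakk>n\<rbrakk>"
proof -
  interpret new: ranked_frame core new_R E "rank core new_R" by (rule ranked_frame_core)
  let ?n = "Suc (card (Pow (Pow S)))"
  have refl: "new_R y y" for y unfolding new_R_def by simp
  have clean: "y = z" if "y \<in> core" "z \<in> core" "new_R y z" "E y z" for y z
    using that(3) cluster_type_E[OF core_W[OF that(1)] core_W[OF that(2)] that(4)]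
    unfolding new_R_def by blast
  have "MplusGrzB \<subseteq> valid core (frel new_R E)"
    by (rule new.MplusGrzB_valid[OF refl clean])
  then have "MplusGrzB\<lbrakk>?n\<rbrakk> \<subseteq> valid core (frel new_R E)"
    by (rule new.with_depth_valid) (simp_all add: less_Suc_eq_le rank_bound)
  moreover obtain y where "y \<in> core" "type_of y = type_of x"
    using core_representative[OF assms(1)] by metis
  moreover from this have "\<not> sat core (frel new_R E) V \<phi> y"
    using sat_core[of y \<phi>] type_of_eqD[of y x \<phi>] assms(2,3) by blast
  ultimately have "\<phi> \<notin> MplusGrzB\<lbrakk>?n\<rbrakk>" unfolding valid_def by blast
  then show ?thesis by (intro exI[of _ ?n]) simp
qed

end

subsection \<open>Passing to the canonical models\<close>

primrec subformulas :: "'m fm \<Rightarrow> 'm fm set" where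
  "subformulas (Var i) = {Var i}"
| "subformulas Falsum = {Falsum}"
| "subformulas (\<phi> \<^bold>\<longrightarrow> \<psi>) = insert (\<phi> \<^bold>\<longrightarrow> \<psi>) (subformulas \<phi> \<union> subformulas \<psi>)"
| "subformulas (Dia m \<phi>) = insert (Dia m \<phi>) (subformulas \<phi>)"

lemma finite_subformulas: "finite (subformulas \<phi>)"
  by (induction \<phi>) auto

lemma subformulas_refl: "\<phi> \<in> subformulas \<phi>"
  by (cases \<phi>) auto

lemma subformulas_Imp: "(\<phi> \<^bold>\<longrightarrow> \<psi>) \<in> subformulas \<chi> \<Longrightarrow> \<phi> \<in> subformulas \<chi> \<and> \<psi> \<in> subformulas \<chi>"
  by (induction \<chi>) (auto simp: subformulas_refl)

lemma subformulas_Dia: "Dia m \<phi> \<in> subformulas \<chi> \<Longrightarrow> \<phi> \<in> subformulas \<chi>"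
  by (induction \<chi>) (auto simp: subformulas_refl)

lemma rule_closure_closed: "rule_closure (rule_closure \<Gamma>) \<subseteq> rule_closure \<Gamma>"
proof
  fix \<phi> assume "\<phi> \<in> rule_closure (rule_closure \<Gamma>)"
  then show "\<phi> \<in> rule_closure \<Gamma>" by induction (auto intro: rule_closure.intros)
qed

lemma extend_closed: "rule_closure (L \<oplus> \<Gamma>) \<subseteq> L \<oplus> \<Gamma>"
  unfolding extend_def by (rule rule_closure_closed)

lemma extend_base: "L \<subseteq> L \<oplus> \<Gamma>" "\<Gamma> \<subseteq> L \<oplus> \<Gamma>"
  unfolding extend_def by (auto intro: rule_closure.base)

lemma MB_fusion: "fusion_S5 L \<subseteq> MB L"
  unfolding MB_def by (meson extend_base(1) order_trans)

lemma MB_temporal: "map_fm (\<lambda>_. Temp) ` L \<subseteq> MB L"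
proof -
  have "map_fm (\<lambda>_. Temp) ` L \<subseteq> fusion_S5 L"
    unfolding fusion_S5_def by (auto intro: rule_closure.base)
  then show ?thesis using MB_fusion[of L] by (rule order_trans)
qed

lemma MB_S5: "map_fm (\<lambda>_. Quant) ` S5 \<subseteq> MB L"
proof -
  have "map_fm (\<lambda>_. Quant) ` S5 \<subseteq> fusion_S5 L"
    unfolding fusion_S5_def by (auto intro: rule_closure.base)
  then show ?thesis using MB_fusion[of L] by (rule order_trans)
qed

lemma MB_axioms:
  "(\<^bold>\<exists> \<^bold>\<diamond> \<^bold>p \<^bold>\<longrightarrow> \<^bold>\<diamond> \<^bold>\<exists> \<^bold>p) \<in> MB L" "(\<^bold>\<diamond> \<^bold>\<exists> \<^bold>p \<^bold>\<longrightarrow> \<^bold>\<exists> \<^bold>\<diamond> \<^bold>p) \<in> MB L"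
  unfolding MB_def using extend_base(2) by (blast intro: subsetD[OF extend_base(1)])+

lemma K_tautology: "\<phi> \<in> tautologies \<Longrightarrow> \<phi> \<in> K"
  unfolding K_def by (blast intro: rule_closure.base)

lemma K_axioms:
  "(\<box> (\<^bold>p \<^bold>\<longrightarrow> \<^bold>q) \<^bold>\<longrightarrow> \<box> \<^bold>p \<^bold>\<longrightarrow> \<box> \<^bold>q) \<in> K"
  "(\<diamond> \<^bold>p \<^bold>\<longrightarrow> \<^bold>\<not> \<box> \<^bold>\<not> \<^bold>p) \<in> K"
  "(\<^bold>\<not> \<box> \<^bold>\<not> \<^bold>p \<^bold>\<longrightarrow> \<diamond> \<^bold>p) \<in> K"
  unfolding K_def by (rule rule_closure.base, simp)+

lemma normal_logicI:
  assumes closed: "rule_closure M \<subseteq> M" and K: "\<And>m. map_fm (\<lambda>_. m) ` K \<subseteq> M"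
  shows "normal_logic M"
proof -
  have M: "map_fm (\<lambda>_. m) \<phi> \<in> M" if "\<phi> \<in> K" for \<phi> m using K[of m] that by blast
  have T: "map_fm (\<lambda>_. m) \<phi> \<in> M" if "\<And>v. bool_eval v \<phi>" for \<phi> :: "unit fm" and m
    by (rule M[OF K_tautology]) (simp add: tautologies_def that)
  show ?thesis
  proof
    fix m
    show "(Var 0 \<^bold>\<longrightarrow> Var 1 \<^bold>\<longrightarrow> Var 0) \<in> M"
      using T[of "Var 0 \<^bold>\<longrightarrow> Var 1 \<^bold>\<longrightarrow> Var 0"] by simp
    show "((Var 0 \<^bold>\<longrightarrow> Var 1 \<^bold>\<longrightarrow> Var 2) \<^bold>\<longrightarrow> (Var 0 \<^bold>\<longrightarrow> Var 1) \<^bold>\<longrightarrow> Var 0 \<^bold>\<longrightarrow> Var 2) \<in> M"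
      using T[of "(Var 0 \<^bold>\<longrightarrow> Var 1 \<^bold>\<longrightarrow> Var 2) \<^bold>\<longrightarrow> (Var 0 \<^bold>\<longrightarrow> Var 1) \<^bold>\<longrightarrow> Var 0 \<^bold>\<longrightarrow> Var 2"] by simp
    show "(\<^bold>\<not> \<^bold>\<not> Var 0 \<^bold>\<longrightarrow> Var 0) \<in> M"
      using T[of "\<^bold>\<not> \<^bold>\<not> Var 0 \<^bold>\<longrightarrow> Var 0"] by simp
    show "(Box m (Var 0 \<^bold>\<longrightarrow> Var 1) \<^bold>\<longrightarrow> Box m (Var 0) \<^bold>\<longrightarrow> Box m (Var 1)) \<in> M"
      using M[OF K_axioms(1), of m] by simp
    show "(Dia m (Var 0) \<^bold>\<longrightarrow> \<^bold>\<not> Box m (\<^bold>\<not> Var 0)) \<in> M"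
      using M[OF K_axioms(2), of m] by simp
    show "(\<^bold>\<not> Box m (\<^bold>\<not> Var 0) \<^bold>\<longrightarrow> Dia m (Var 0)) \<in> M"
      using M[OF K_axioms(3), of m] by simp
  qed (fact closed)
qed

lemma normal_logic_MB_extension:
  assumes "rule_closure M \<subseteq> M" "MB L \<subseteq> M" "K \<subseteq> L"
  shows "normal_logic M"
proof (rule normal_logicI[OF assms(1)])
  fix m
  have "K \<subseteq> S5" unfolding S5_def by (rule extend_base)
  then show "map_fm (\<lambda>_. m) ` K \<subseteq> M"
    using MB_temporal[of L] MB_S5[of L] assms(2,3) by (cases m) blast+
qed

text \<open>Each axiom is canonical. The commutation axioms turn a two-step path from
  \<open>x\<close> to \<open>z\<close> into exactly the hypothesis of \<open>acc_comp\<close> for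
  the two modalities in the opposite order.\<close>

lemma canonical_commuting_frame:
  assumes logic: "normal_logic M" and MB: "MB L \<subseteq> M"
    and four: "\<And>a. (\<^bold>\<diamond> \<^bold>\<diamond> a \<^bold>\<longrightarrow> \<^bold>\<diamond> a) \<in> M"
  shows "commuting_frame (Collect (normal_logic.world M)) (normal_logic.acc Temp) (normal_logic.acc Quant)"
proof -
  interpret normal_logic M by (rule logic)
  have S5: "map_fm (\<lambda>_. Quant) \<phi> \<in> M" if "\<phi> \<in> {\<^bold>p \<^bold>\<longrightarrow> \<diamond> \<^bold>p, \<diamond> \<diamond> \<^bold>p \<^bold>\<longrightarrow> \<diamond> \<^bold>p, \<^bold>p \<^bold>\<longrightarrow> \<box> \<diamond> \<^bold>p}" for \<phi>
    using that extend_base(2) MB_S5[of L] MB unfolding S5_def by blast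
  have T: "(a \<^bold>\<longrightarrow> \<^bold>\<exists> a) \<in> M" for a
    using inst[OF S5[of "\<^bold>p \<^bold>\<longrightarrow> \<diamond> \<^bold>p"], of "\<lambda>_. a"] by simp
  have 4: "(\<^bold>\<exists> \<^bold>\<exists> a \<^bold>\<longrightarrow> \<^bold>\<exists> a) \<in> M" for a
    using inst[OF S5[of "\<diamond> \<diamond> \<^bold>p \<^bold>\<longrightarrow> \<diamond> \<^bold>p"], of "\<lambda>_. a"] by simp
  have B: "(a \<^bold>\<longrightarrow> \<^bold>\<forall> \<^bold>\<exists> a) \<in> M" for a
    using inst[OF S5[of "\<^bold>p \<^bold>\<longrightarrow> \<box> \<diamond> \<^bold>p"], of "\<lambda>_. a"] by simp
  have ED: "(\<^bold>\<exists> \<^bold>\<diamond> a \<^bold>\<longrightarrow> \<^bold>\<diamond> \<^bold>\<exists> a) \<in> M" for a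
    using inst[of "\<^bold>\<exists> \<^bold>\<diamond> \<^bold>p \<^bold>\<longrightarrow> \<^bold>\<diamond> \<^bold>\<exists> \<^bold>p" "\<lambda>_. a"] MB MB_axioms(1)[of L] by auto
  have DE: "(\<^bold>\<diamond> \<^bold>\<exists> a \<^bold>\<longrightarrow> \<^bold>\<exists> \<^bold>\<diamond> a) \<in> M" for a
    using inst[of "\<^bold>\<diamond> \<^bold>\<exists> \<^bold>p \<^bold>\<longrightarrow> \<^bold>\<exists> \<^bold>\<diamond> \<^bold>p" "\<lambda>_. a"] MB MB_axioms(2)[of L] by auto
  show ?thesis
  proof
    fix x assume x: "x \<in> Collect world"
    then show "acc Quant x x"
      unfolding acc_def using world_L[OF _ T] world_Imp[of x] by blast
  next
    fix x y assume xy: "x \<in> Collect world" "y \<in> Collect world" "acc Quant x y"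
    show "acc Quant y x"
      unfolding acc_def
    proof
      fix a assume "a \<in> x"
      then have "\<^bold>\<forall> \<^bold>\<exists> a \<in> x" using world_L[OF _ B, of x a] world_Imp[of x] xy(1) by blast
      then show "\<^bold>\<exists> a \<in> y" using acc_Box[of x y Quant] xy by blast
    qed
  next
    fix x y z assume W: "x \<in> Collect world" "y \<in> Collect world" "z \<in> Collect world"
    note x = W(1)[unfolded mem_Collect_eq] and z = W(3)[unfolded mem_Collect_eq]
    show "acc Quant x y \<Longrightarrow> acc Quant y z \<Longrightarrow> acc Quant x z" using acc_trans[OF 4 x] .
    show "acc Temp x y \<Longrightarrow> acc Temp y z \<Longrightarrow> acc Temp x z" using acc_trans[OF four x] .
    show "\<exists>u\<in>Collect world. acc Temp x u \<and> acc Quant u z" if "acc Quant x y" "acc Temp y z"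
    proof -
      have "\<^bold>\<diamond> \<^bold>\<exists> a \<in> x" if "a \<in> z" for a
        using \<open>acc Quant x y\<close> \<open>acc Temp y z\<close> that world_L[OF x ED[of a]] world_Imp[OF x]
        unfolding acc_def by blast
      then show ?thesis using acc_comp[OF x z, of Temp Quant] by blast
    qed
    show "\<exists>u\<in>Collect world. acc Quant x u \<and> acc Temp u z" if "acc Temp x y" "acc Quant y z"
    proof -
      have "\<^bold>\<exists> \<^bold>\<diamond> a \<in> x" if "a \<in> z" for a
        using \<open>acc Temp x y\<close> \<open>acc Quant y z\<close> that world_L[OF x DE[of a]] world_Imp[OF x]
        unfolding acc_def by blast
      then show ?thesis using acc_comp[OF x z, of Quant Temp] by blast
    qed
  qed
qed

text \<open>Bridges the frame locales, which take two separate relations, and the canonical model,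
  whose relation is indexed by the modality.\<close>

lemma frel_acc: "frel (r Temp) (r Quant) = r"
  by (intro ext) (simp add: frel_def split: modality.split)

lemma finite_languageI:
  assumes "commuting_frame W R E"
  shows "finite_language W R E (subformulas \<phi>)"
  using assms unfolding finite_language_def finite_language_axioms_def
  by (blast intro: finite_subformulas subformulas_Imp[THEN conjunct1] subformulas_Imp[THEN conjunct2] subformulas_Dia)

section \<open>The canonical models satisfy the conditions required for thinning\<close>

lemma MGLB_refutation:
  assumes "\<phi> \<notin> MGLB"
  shows "\<exists>n\<ge>1. \<phi> \<notin> MGLB\<lbrakk>n\<rbrakk>"
proof -
  have "K \<subseteq> GL" unfolding GL_def by (rule extend_base)
  then have logic: "normal_logic MGLB"
    unfolding MGLB_def by (rule normal_logic_MB_extension[rotated 2]) (simp_all add: MB_def extend_closed)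
  interpret normal_logic MGLB by (rule logic)
  have "map_fm (\<lambda>_. Temp) (\<box> (\<box> \<^bold>p \<^bold>\<longrightarrow> \<^bold>p) \<^bold>\<longrightarrow> \<box> \<^bold>p) \<in> MGLB"
    using extend_base(2) MB_temporal[of GL] unfolding MGLB_def GL_def by blast
  then have GL: "(\<^bold>\<box> (\<^bold>\<box> a \<^bold>\<longrightarrow> a) \<^bold>\<longrightarrow> \<^bold>\<box> a) \<in> MGLB" for a
    using inst[of "\<^bold>\<box> (\<^bold>\<box> \<^bold>p \<^bold>\<longrightarrow> \<^bold>p) \<^bold>\<longrightarrow> \<^bold>\<box> \<^bold>p" "\<lambda>_. a"] by simp
  have "commuting_frame (Collect world) (acc Temp) (acc Quant)"
    by (rule canonical_commuting_frame[OF logic _ dia_dia_GL[OF logic GL], of GL]) (simp add: MGLB_def)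
  then interpret finite_language "Collect world" "acc Temp" "acc Quant" canonical_val "subformulas \<phi>"
    by (rule finite_languageI)
  interpret GL_model "Collect world" "acc Temp" "acc Quant" canonical_val "subformulas \<phi>"
  proof
    fix P :: "modality fm set \<Rightarrow> bool" and x y
    assume P: "definable P" and W: "x \<in> Collect world" "y \<in> Collect world" and xy: "acc Temp x y" "P y"
    obtain \<psi> where \<psi>: "\<forall>x\<in>Collect world. holds \<psi> x \<longleftrightarrow> P x" using P unfolding definable_def by blast
    \<comment> \<open>With \<open>\<psi>\<close> defining \<open>P\<close>, the Loeb axiom for the
      negation of \<open>\<psi>\<close> says contrapositively that a point seeing \<open>P\<close>
      sees a last point of \<open>P\<close>.\<close>
    have "holds (\<^bold>\<box> (\<^bold>\<box> \<^bold>\<not> \<psi> \<^bold>\<longrightarrow> \<^bold>\<not> \<psi>) \<^bold>\<longrightarrow> \<^bold>\<box> \<^bold>\<not> \<psi>) x"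
      unfolding frel_acc using canonical_sound[OF _ GL] W(1) by blast
    moreover have "\<not> holds (\<^bold>\<box> \<^bold>\<not> \<psi>) x" unfolding sat_Box using xy W(2) \<psi> by auto
    ultimately have "\<not> holds (\<^bold>\<box> (\<^bold>\<box> \<^bold>\<not> \<psi> \<^bold>\<longrightarrow> \<^bold>\<not> \<psi>)) x" by (rule sat_Imp_contra)
    then obtain z where z: "z \<in> Collect world" "acc Temp x z" "\<not> holds (\<^bold>\<box> \<^bold>\<not> \<psi> \<^bold>\<longrightarrow> \<^bold>\<not> \<psi>) z"
      unfolding sat_Box[of _ _ _ _ "\<^bold>\<box> \<^bold>\<not> \<psi> \<^bold>\<longrightarrow> \<^bold>\<not> \<psi>"] by auto
    then have "holds (\<^bold>\<box> \<^bold>\<not> \<psi>) z" "holds \<psi> z" using not_sat_ImpD[OF z(3)] by simp_all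
    then show "\<exists>z\<in>Collect world. acc Temp x z \<and> P z \<and> (\<forall>u\<in>Collect world. acc Temp z u \<longrightarrow> \<not> P u)"
      unfolding sat_Box using z(1,2) \<psi> by (intro bexI[of _ z]) auto
  qed
  obtain w where "world w" "\<not> sat (Collect world) acc canonical_val \<phi> w"
    using canonical_complete[OF assms] by blast
  then show ?thesis
    using bounded_depth_refutation[of w \<phi>] subformulas_refl unfolding frel_acc by blast
qed

lemma MplusGrzB_refutation:
  assumes "\<phi> \<notin> MplusGrzB"
  shows "\<exists>n\<ge>1. \<phi> \<notin> MplusGrzB\<lbrakk>n\<rbrakk>"
proof -
  have MB: "MB Grz \<subseteq> MplusGrzB" unfolding MplusGrzB_def MGrzB_def by (rule extend_base)
  have "K \<subseteq> Grz" unfolding Grz_def by (rule extend_base)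
  then have logic: "normal_logic MplusGrzB"
    by (rule normal_logic_MB_extension[OF _ MB, rotated]) (simp add: MplusGrzB_def extend_closed)
  interpret normal_logic MplusGrzB by (rule logic)
  have "map_fm (\<lambda>_. Temp) (\<box> (\<box> (\<^bold>p \<^bold>\<longrightarrow> \<box> \<^bold>p) \<^bold>\<longrightarrow> \<^bold>p) \<^bold>\<longrightarrow> \<^bold>p) \<in> MplusGrzB"
    using extend_base(2) MB_temporal[of Grz] MB unfolding Grz_def by blast
  then have Grz: "(\<^bold>\<box> (\<^bold>\<box> (a \<^bold>\<longrightarrow> \<^bold>\<box> a) \<^bold>\<longrightarrow> a) \<^bold>\<longrightarrow> a) \<in> MplusGrzB" for a
    using inst[of "\<^bold>\<box> (\<^bold>\<box> (\<^bold>p \<^bold>\<longrightarrow> \<^bold>\<box> \<^bold>p) \<^bold>\<longrightarrow> \<^bold>p) \<^bold>\<longrightarrow> \<^bold>p" "\<lambda>_. a"] by simp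
  have "(\<^bold>\<box> \<^bold>\<forall> (\<^bold>\<box> (\<^bold>\<box> \<^bold>p \<^bold>\<longrightarrow> \<^bold>\<box> \<^bold>\<forall> \<^bold>p) \<^bold>\<longrightarrow> \<^bold>\<box> \<^bold>\<forall> \<^bold>p) \<^bold>\<longrightarrow> \<^bold>\<box> \<^bold>\<forall> \<^bold>p) \<in> MplusGrzB"
    using extend_base(2) unfolding MplusGrzB_def by blast
  then have Casari: "(\<^bold>\<box> \<^bold>\<forall> (\<^bold>\<box> (\<^bold>\<box> a \<^bold>\<longrightarrow> \<^bold>\<box> \<^bold>\<forall> a) \<^bold>\<longrightarrow> \<^bold>\<box> \<^bold>\<forall> a) \<^bold>\<longrightarrow> \<^bold>\<box> \<^bold>\<forall> a) \<in> MplusGrzB" for a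
    using inst[of "\<^bold>\<box> \<^bold>\<forall> (\<^bold>\<box> (\<^bold>\<box> \<^bold>p \<^bold>\<longrightarrow> \<^bold>\<box> \<^bold>\<forall> \<^bold>p) \<^bold>\<longrightarrow> \<^bold>\<box> \<^bold>\<forall> \<^bold>p) \<^bold>\<longrightarrow> \<^bold>\<box> \<^bold>\<forall> \<^bold>p" "\<lambda>_. a"] by simp
  have "commuting_frame (Collect world) (acc Temp) (acc Quant)"
    by (rule canonical_commuting_frame[OF logic MB dia_dia_Grz[OF logic Grz]])
  then interpret finite_language "Collect world" "acc Temp" "acc Quant" canonical_val "subformulas \<phi>"
    by (rule finite_languageI)
  have refl: "acc Temp x x" if "world x" for x
    unfolding acc_def using world_L[OF that dia_Grz[OF logic Grz]] world_Imp[OF that] by blast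
  interpret MplusGrz_model "Collect world" "acc Temp" "acc Quant" canonical_val "subformulas \<phi>"
  proof
    show "x \<in> Collect world \<Longrightarrow> acc Temp x x" for x using refl by blast
  next
    fix P :: "modality fm set \<Rightarrow> bool" and x
    assume P: "definable P" and x: "x \<in> Collect world" "P x"
    obtain \<psi> where \<psi>: "\<forall>x\<in>Collect world. holds \<psi> x \<longleftrightarrow> P x" using P unfolding definable_def by blast
    let ?q = "\<^bold>\<not> \<psi>"
    have "holds (\<^bold>\<box> (\<^bold>\<box> (?q \<^bold>\<longrightarrow> \<^bold>\<box> ?q) \<^bold>\<longrightarrow> ?q) \<^bold>\<longrightarrow> ?q) x"
      unfolding frel_acc using canonical_sound[OF _ Grz] x(1) by blast
    moreover have "\<not> holds ?q x" using x \<psi> by simp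
    ultimately have "\<not> holds (\<^bold>\<box> (\<^bold>\<box> (?q \<^bold>\<longrightarrow> \<^bold>\<box> ?q) \<^bold>\<longrightarrow> ?q)) x" by (rule sat_Imp_contra)
    then obtain y where y: "y \<in> Collect world" "acc Temp x y" "\<not> holds (\<^bold>\<box> (?q \<^bold>\<longrightarrow> \<^bold>\<box> ?q) \<^bold>\<longrightarrow> ?q) y"
      unfolding sat_Box[of _ _ _ _ "\<^bold>\<box> (?q \<^bold>\<longrightarrow> \<^bold>\<box> ?q) \<^bold>\<longrightarrow> ?q"] by auto
    then have box: "holds (\<^bold>\<box> (?q \<^bold>\<longrightarrow> \<^bold>\<box> ?q)) y" and "holds \<psi> y" using not_sat_ImpD[OF y(3)] by simp_all
    have "\<not> P v" if "u \<in> Collect world" "v \<in> Collect world" "acc Temp y u" "\<not> P u" "acc Temp u v" for u v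
    proof -
      have "holds (?q \<^bold>\<longrightarrow> \<^bold>\<box> ?q) u" using box that(1,3) unfolding sat_Box[of _ _ _ _ "?q \<^bold>\<longrightarrow> \<^bold>\<box> ?q"] by simp
      moreover have "holds ?q u" using that(1,4) \<psi> by simp
      ultimately have "holds (\<^bold>\<box> ?q) u" by (rule sat_ImpD)
      then show ?thesis unfolding sat_Box using that(2,5) \<psi> by simp
    qed
    then show "\<exists>y\<in>Collect world. acc Temp x y \<and> P y \<and> (\<forall>u\<in>Collect world. \<forall>v\<in>Collect world.
        acc Temp y u \<longrightarrow> \<not> P u \<longrightarrow> acc Temp u v \<longrightarrow> \<not> P v)"
      using y(1,2) \<open>holds \<psi> y\<close> \<psi> by blast
  next
    fix P :: "modality fm set \<Rightarrow> bool" and x y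
    assume P: "definable P" and W: "x \<in> Collect world" "y \<in> Collect world" and xy: "above x y" "P y"
    obtain \<psi> where \<psi>: "\<forall>x\<in>Collect world. holds \<psi> x \<longleftrightarrow> P x" using P unfolding definable_def by blast
    let ?q = "\<^bold>\<not> \<psi>"
    let ?step = "\<^bold>\<box> ?q \<^bold>\<longrightarrow> \<^bold>\<box> \<^bold>\<forall> ?q"
    \<comment> \<open>Box followed by "for all" is the box of the relation \<open>above\<close>, so
      the Casari-type axiom can be read on clusters.\<close>
    have box_all: "holds (\<^bold>\<box> \<^bold>\<forall> a) u \<longleftrightarrow> (\<forall>v\<in>Collect world. above u v \<longrightarrow> holds a v)" for a u
      unfolding sat_Box above_def frel_simps by blast
    have "holds (\<^bold>\<box> \<^bold>\<forall> (\<^bold>\<box> ?step \<^bold>\<longrightarrow> \<^bold>\<box> \<^bold>\<forall> ?q) \<^bold>\<longrightarrow> \<^bold>\<box> \<^bold>\<forall> ?q) x"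
      unfolding frel_acc using canonical_sound[OF _ Casari] W(1) by blast
    moreover have "\<not> holds (\<^bold>\<box> \<^bold>\<forall> ?q) x" unfolding box_all using xy W(2) \<psi> by auto
    ultimately have "\<not> holds (\<^bold>\<box> \<^bold>\<forall> (\<^bold>\<box> ?step \<^bold>\<longrightarrow> \<^bold>\<box> \<^bold>\<forall> ?q)) x" by (rule sat_Imp_contra)
    then obtain c where c: "c \<in> Collect world" "above x c" "\<not> holds (\<^bold>\<box> ?step \<^bold>\<longrightarrow> \<^bold>\<box> \<^bold>\<forall> ?q) c"
      unfolding box_all[of "\<^bold>\<box> ?step \<^bold>\<longrightarrow> \<^bold>\<box> \<^bold>\<forall> ?q"] by blast
    then have "holds (\<^bold>\<box> ?step) c" and no: "\<not> holds (\<^bold>\<box> \<^bold>\<forall> ?q) c" using not_sat_ImpD[OF c(3)] by simp_all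
    then have step: "holds ?step u" if "u \<in> Collect world" "acc Temp c u" for u
      using that unfolding sat_Box[of _ _ _ _ ?step] by simp
    \<comment> \<open>The point \<open>c\<close> need not satisfy \<open>P\<close>. Since the
      implication \<open>?step\<close> holds at \<open>c\<close> by reflexivity and its conclusion
      fails there, \<open>c\<close> has an \<open>R\<close>-successor \<open>z\<close> in
      \<open>P\<close>; by transitivity \<open>?step\<close> also holds at everything beyond
      \<open>z\<close>.\<close>
    have "\<not> holds (\<^bold>\<box> ?q) c"
      by (rule sat_Imp_contra[OF step[OF c(1)] no]) (use refl c(1) in blast)
    then obtain z where z: "z \<in> Collect world" "acc Temp c z" "P z"
      unfolding sat_Box using \<psi> by auto
    have "\<exists>w\<in>Collect world. acc Temp u w \<and> P w"
      if u: "u \<in> Collect world" "v \<in> Collect world" "acc Temp z u" "above u v" "P v" for u v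
    proof -
      have "\<not> holds (\<^bold>\<box> \<^bold>\<forall> ?q) u" unfolding box_all using u(2,4,5) \<psi> by auto
      then have "\<not> holds (\<^bold>\<box> ?q) u"
        by (rule sat_Imp_contra[OF step[OF u(1) R_trans[OF c(1) z(1) u(1) z(2) u(3)]]])
      then show ?thesis unfolding sat_Box using \<psi> by auto
    qed
    moreover have "above x z" using above_trans[OF W(1) c(1) z(1) c(2) above_R[OF z(1,2)]] .
    ultimately show "\<exists>z\<in>Collect world. above x z \<and> P z \<and> (\<forall>u\<in>Collect world. \<forall>v\<in>Collect world.
        acc Temp z u \<longrightarrow> above u v \<longrightarrow> P v \<longrightarrow> (\<exists>w\<in>Collect world. acc Temp u w \<and> P w))"
      using z(1,3) by blast
  qed
  obtain w where "world w" "\<not> sat (Collect world) acc canonical_val \<phi> w"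
    using canonical_complete[OF assms] by blast
  then show ?thesis
    using bounded_depth_refutation[of w \<phi>] subformulas_refl unfolding frel_acc by blast
qed

theorem mainTheorem9:
  "MGLB = (\<Inter>n\<in>{1..}. MGLB\<lbrakk>n\<rbrakk>) \<and> MplusGrzB = (\<Inter>n\<in>{1..}. MplusGrzB\<lbrakk>n\<rbrakk>)"
proof -
  have "M = (\<Inter>n\<in>{1..}. M\<lbrakk>n\<rbrakk>)" if "\<And>\<phi>. \<phi> \<notin> M \<Longrightarrow> \<exists>n\<ge>1. \<phi> \<notin> M\<lbrakk>n\<rbrakk>" for M
  proof (rule equalityI)
    show "M \<subseteq> (\<Inter>n\<in>{1..}. M\<lbrakk>n\<rbrakk>)"
      unfolding with_depth_def using extend_base(1) by blast
    show "(\<Inter>n\<in>{1..}. M\<lbrakk>n\<rbrakk>) \<subseteq> M" using that by fastforce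
  qed
  then show ?thesis using MGLB_refutation MplusGrzB_refutation by blast
qed

end
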